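(* Let $\mathcal{A}=(a_{i_1\dots i_m})$ be a real symmetric tensor of even order $m$ and dimension $n$, and let $\Omega(\mathcal{A})$ (the Brauer-type eigenvalues inclusion set) and $\Psi(\mathcal{A})$ (the quasi-double $\overline{B}$-intervals) be the sets defined in the context. If $\lambda$ is an $H$-eigenvalue of $\mathcal{A}$, then $$\lambda\in\Upsilon(\mathcal{A})=\Omega(\mathcal{A})\cap\Psi(\mathcal{A}).$$
   Context: $[n]=\{1,\dots,n\}$. A real tensor $\mathcal{A}$ of order $m$ and dimension $n$ is an array $(a_{i_1\dots i_m})$ of real numbers with all $i_j\in[n]$; it is symmetric if its entries are invariant under any permutation of their indices. With $(\mathcal{A}x^{m-1})_i=\sum_{i_2,\dots,i_m=1}^n a_{ii_2\dots i_m}x_{i_2}\cdots x_{i_m}$ and $(x^{[m-1]})_i=x_i^{m-1}$, a real number $\lambda$ is an $H$-eigenvalue of $\mathcal{A}$ if there is a nonzero $x\in\mathbb{R}^n$ with $\mathcal{A}x^{m-1}=\lambda x^{[m-1]}$. The entry $a_{ji\dots i}$ has first index $j$ and the remaining $m-1$ indices equal to $i$. Definition of $\Omega(\mathcal{A})$. Let $r_i(\mathcal{A})=\sum_{(i_2,\dots,i_m)\neq(i,\dots,i)}|a_{ii_2\dots i_m}|$ and, for $i\neq j$, $r_j^i(\mathcal{A})=r_j(\mathcal{A})-|a_{ji\dots i}|$. Then $\Omega(\mathcal{A})=\bigcup_{i,j\in[n],\,i\neq j}\Omega_{ij}(\mathcal{A})$ with $\Omega_{ij}(\mathcal{A})=\{z\in\mathbb{C}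 : |z-a_{i\dots i}|(|z-a_{j\dots j}|-r_j^i(\mathcal{A}))\leq r_i(\mathcal{A})|a_{ji\dots i}|\}$. Definition of $\Psi(\mathcal{A})$. For $i\neq j\in[n]$ let (all for $\mathcal{A}$) $\beta_i=\max\{0,\ a_{ii_2\dots i_m} : (i_2,\dots,i_m)\neq(i,\dots,i)\}$; $\gamma_i=\min\{0,\ a_{ii_2\dots i_m} : (i_2,\dots,i_m)\neq(i,\dots,i)\}$; $\Delta_i=\sum_{(i_2,\dots,i_m)\neq(i,\dots,i)}(\beta_i-a_{ii_2\dots i_m})$; $\Theta_i=\sum_{(i_2,\dots,i_m)\neq(i,\dots,i)}(a_{ii_2\dots i_m}-\gamma_i)$; $\Delta_j^i=\sum(\beta_j-a_{jj_2\dots j_m})$ and $\Theta_j^i=\sum(a_{jj_2\dots j_m}-\gamma_j)$, both sums over all $(j_2,\dots,j_m)\in[n]^{m-1}$ different from $(i,\dots,i)$ and from $(j,\dots,j)$. For $i\in[n]$ let $\Psi_i=[a_{i\dots i}-\beta_i,\ a_{i\dots i}-\gamma_i]$. For $i\neq j$ let $\Psi^1_{ij}=\{x\in(-\infty,\min\{a_{i\dots i},a_{j\dots j}\}) : |a_{i\dots i}-\beta_i-x|(|a_{j\dots j}-\beta_j-x|-\Delta_j^i)\leq(\beta_j-a_{ji\dots i})\Delta_i\}$, $\Psi^2_{ij}=\{x\in(a_{i\dots i},a_{j\dots j}) : |a_{i\dots i}-\gamma_i-x|(|a_{j\dots j}-\beta_j-x|-\Delta_j^i)\leq(\beta_j-a_{ji\dots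 i})\Theta_i\}$, $\Psi^3_{ij}=\{x\in(a_{j\dots j},a_{i\dots i}) : |a_{i\dots i}-\beta_i-x|(|a_{j\dots j}-\gamma_j-x|-\Theta_j^i)\leq(a_{ji\dots i}-\gamma_j)\Delta_i\}$, $\Psi^4_{ij}=\{x\in(\max\{a_{i\dots i},a_{j\dots j}\},+\infty) : |a_{i\dots i}-\gamma_i-x|(|a_{j\dots j}-\gamma_j-x|-\Theta_j^i)\leq(a_{ji\dots i}-\gamma_j)\Theta_i\}$ (an open interval $(c,d)$ with $c\geq d$ is empty). Let $\Psi_{ij}=\Psi^1_{ij}\cup\Psi^2_{ij}\cup\Psi^4_{ij}$ if $a_{i\dots i}\leq a_{j\dots j}$ and $\Psi_{ij}=\Psi^1_{ij}\cup\Psi^3_{ij}\cup\Psi^4_{ij}$ if $a_{i\dots i}\geq a_{j\dots j}$. Then $\Psi(\mathcal{A})=(\bigcup_{i=1}^n\Psi_i)\cup(\bigcup_{i\neq j}\Psi_{ij})$.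
   Formalization: The dimension n is assumed to be at least 2: for n = 1 there are no pairs i ≠ j, so Ω(A) is empty although the single entry of A is an H-eigenvalue, and the claim fails as written. *)

theory Defs
  imports "HOL-Analysis.Analysis"
begin

(* A tensor of order m and dimension n = CARD('n) is a function on index lists;
   only its values on lists of length m are its entries.  The first index is
   split off as the head, so the entry with indices i, i_2, ..., i_m is A (i # is)
   with is in multi_indices (m - 1). *)
type_synonym 'n tensor = "'n list \<Rightarrow> real"

definition multi_indices :: "nat \<Rightarrow> 'n list set" where
  "multi_indices k = {js. length js = k}"

definition symmetric_tensor :: "nat \<Rightarrow> 'n tensor \<Rightarrow> bool" where
  "symmetric_tensor m A \<longleftrightarrow>
     (\<forall>js\<in>multi_indices m. \<forall>ks\<in>multi_indices m. mset js = mset ks \<longrightarrow> A js = A ks)"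

definition tensor_apply :: "nat \<Rightarrow> 'n::finite tensor \<Rightarrow> real ^ 'n \<Rightarrow> real ^ 'n" where
  "tensor_apply m A x =
     (\<chi> i. \<Sum>js\<in>multi_indices (m - 1). A (i # js) * prod_list (map (\<lambda>j. x $ j) js))"

definition vec_power :: "real ^ 'n \<Rightarrow> nat \<Rightarrow> real ^ 'n::finite" where
  "vec_power x k = (\<chi> i. (x $ i) ^ k)"

definition H_eigenvalue :: "nat \<Rightarrow> 'n::finite tensor \<Rightarrow> real \<Rightarrow> bool" where
  "H_eigenvalue m A lam \<longleftrightarrow>
     (\<exists>x. x \<noteq> 0 \<and> tensor_apply m A x = lam *\<^sub>R vec_power x (m - 1))"

definition diag_entry :: "nat \<Rightarrow> 'n tensor \<Rightarrow> 'n \<Rightarrow> real" where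
  "diag_entry m A i = A (replicate m i)"

(* The entry with first index j and all remaining indices equal to i. *)
definition semi_diag_entry :: "nat \<Rightarrow> 'n tensor \<Rightarrow> 'n \<Rightarrow> 'n \<Rightarrow> real" where
  "semi_diag_entry m A j i = A (j # replicate (m - 1) i)"

definition off_diag :: "nat \<Rightarrow> 'n \<Rightarrow> 'n list set" where
  "off_diag m i = multi_indices (m - 1) - {replicate (m - 1) i}"

definition off_diag2 :: "nat \<Rightarrow> 'n \<Rightarrow> 'n \<Rightarrow> 'n list set" where
  "off_diag2 m i j = multi_indices (m - 1) - {replicate (m - 1) i, replicate (m - 1) j}"


definition row_radius :: "nat \<Rightarrow> 'n::finite tensor \<Rightarrow> 'n \<Rightarrow> real" where
  "row_radius m A i = (\<Sum>js\<in>off_diag m i. \<bar>A (i # js)\<bar>)"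

(* row_radius_except m A j i is r_j^i(A). *)
definition row_radius_except :: "nat \<Rightarrow> 'n::finite tensor \<Rightarrow> 'n \<Rightarrow> 'n \<Rightarrow> real" where
  "row_radius_except m A j i = row_radius m A j - \<bar>semi_diag_entry m A j i\<bar>"

definition Omega_pair :: "nat \<Rightarrow> 'n::finite tensor \<Rightarrow> 'n \<Rightarrow> 'n \<Rightarrow> complex set" where
  "Omega_pair m A i j =
     {z. cmod (z - complex_of_real (diag_entry m A i))
           * (cmod (z - complex_of_real (diag_entry m A j)) - row_radius_except m A j i)
         \<le> row_radius m A i * \<bar>semi_diag_entry m A j i\<bar>}"

definition Omega :: "nat \<Rightarrow> 'n::finite tensor \<Rightarrow> complex set" where
  "Omega m A = (\<Union>i. \<Union>j\<in>{j. j \<noteq> i}. Omega_pair m A i j)"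


definition beta :: "nat \<Rightarrow> 'n::finite tensor \<Rightarrow> 'n \<Rightarrow> real" where
  "beta m A i = Max (insert 0 ((\<lambda>js. A (i # js)) ` off_diag m i))"

definition gamma :: "nat \<Rightarrow> 'n::finite tensor \<Rightarrow> 'n \<Rightarrow> real" where
  "gamma m A i = Min (insert 0 ((\<lambda>js. A (i # js)) ` off_diag m i))"

definition Delta :: "nat \<Rightarrow> 'n::finite tensor \<Rightarrow> 'n \<Rightarrow> real" where
  "Delta m A i = (\<Sum>js\<in>off_diag m i. beta m A i - A (i # js))"

definition Theta :: "nat \<Rightarrow> 'n::finite tensor \<Rightarrow> 'n \<Rightarrow> real" where
  "Theta m A i = (\<Sum>js\<in>off_diag m i. A (i # js) - gamma m A i)"

(* Delta_except m A j i and Theta_except m A j i carry the lower index j and the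
   upper index i. *)
definition Delta_except :: "nat \<Rightarrow> 'n::finite tensor \<Rightarrow> 'n \<Rightarrow> 'n \<Rightarrow> real" where
  "Delta_except m A j i = (\<Sum>js\<in>off_diag2 m i j. beta m A j - A (j # js))"

definition Theta_except :: "nat \<Rightarrow> 'n::finite tensor \<Rightarrow> 'n \<Rightarrow> 'n \<Rightarrow> real" where
  "Theta_except m A j i = (\<Sum>js\<in>off_diag2 m i j. A (j # js) - gamma m A j)"

definition Psi_single :: "nat \<Rightarrow> 'n::finite tensor \<Rightarrow> 'n \<Rightarrow> real set" where
  "Psi_single m A i = {diag_entry m A i - beta m A i .. diag_entry m A i - gamma m A i}"

definition Psi1 :: "nat \<Rightarrow> 'n::finite tensor \<Rightarrow> 'n \<Rightarrow> 'n \<Rightarrow> real set" where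
  "Psi1 m A i j =
     {x \<in> {..<min (diag_entry m A i) (diag_entry m A j)}.
        \<bar>diag_entry m A i - beta m A i - x\<bar>
          * (\<bar>diag_entry m A j - beta m A j - x\<bar> - Delta_except m A j i)
        \<le> (beta m A j - semi_diag_entry m A j i) * Delta m A i}"

definition Psi2 :: "nat \<Rightarrow> 'n::finite tensor \<Rightarrow> 'n \<Rightarrow> 'n \<Rightarrow> real set" where
  "Psi2 m A i j =
     {x \<in> {diag_entry m A i<..<diag_entry m A j}.
        \<bar>diag_entry m A i - gamma m A i - x\<bar>
          * (\<bar>diag_entry m A j - beta m A j - x\<bar> - Delta_except m A j i)
        \<le> (beta m A j - semi_diag_entry m A j i) * Theta m A i}"

definition Psi3 :: "nat \<Rightarrow> 'n::finite tensor \<Rightarrow> 'n \<Rightarrow> 'n \<Rightarrow> real set" where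
  "Psi3 m A i j =
     {x \<in> {diag_entry m A j<..<diag_entry m A i}.
        \<bar>diag_entry m A i - beta m A i - x\<bar>
          * (\<bar>diag_entry m A j - gamma m A j - x\<bar> - Theta_except m A j i)
        \<le> (semi_diag_entry m A j i - gamma m A j) * Delta m A i}"

definition Psi4 :: "nat \<Rightarrow> 'n::finite tensor \<Rightarrow> 'n \<Rightarrow> 'n \<Rightarrow> real set" where
  "Psi4 m A i j =
     {x \<in> {max (diag_entry m A i) (diag_entry m A j)<..}.
        \<bar>diag_entry m A i - gamma m A i - x\<bar>
          * (\<bar>diag_entry m A j - gamma m A j - x\<bar> - Theta_except m A j i)
        \<le> (semi_diag_entry m A j i - gamma m A j) * Theta m A i}"

(* For equal diagonal entries both Psi2 and Psi3 are empty, so the two cases of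
   the definition agree there. *)
definition Psi_pair :: "nat \<Rightarrow> 'n::finite tensor \<Rightarrow> 'n \<Rightarrow> 'n \<Rightarrow> real set" where
  "Psi_pair m A i j =
     (if diag_entry m A i \<le> diag_entry m A j
      then Psi1 m A i j \<union> Psi2 m A i j \<union> Psi4 m A i j
      else Psi1 m A i j \<union> Psi3 m A i j \<union> Psi4 m A i j)"

definition Psi :: "nat \<Rightarrow> 'n::finite tensor \<Rightarrow> real set" where
  "Psi m A = (\<Union>i. Psi_single m A i) \<union> (\<Union>i. \<Union>j\<in>{j. j \<noteq> i}. Psi_pair m A i j)"

(* Omega is a set of complex numbers and Psi a set of reals; the intersection is
   taken in the complex plane. *)
definition Upsilon :: "nat \<Rightarrow> 'n::finite tensor \<Rightarrow> complex set" where
  "Upsilon m A = Omega m A \<inter> complex_of_real ` Psi m A"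

end

theory Submission
  imports Defs
begin

text \<open>Fix an eigenpair \<open>lam\<close>, \<open>x\<close>. Membership in \<open>Omega\<close> is the argument of Brauer: in the row of a
  coordinate \<open>j\<close> of largest modulus all entries except \<open>a_{j i ... i}\<close> are estimated by the maximum,
  row \<open>i\<close> is estimated completely, and the product of the two inequalities is the claim.

  For \<open>Psi\<close> suppose that \<open>lam\<close> lies outside. Leaving \<open>Psi_single\<close> gives every row a sign
  \<open>eps i\<close>, namely \<open>1\<close> if \<open>lam < a_{i ... i} - beta_i\<close> and \<open>-1\<close> if \<open>lam > a_{i ... i} - gamma_i\<close>.
  With \<open>b_i = beta_i\<close> or \<open>b_i = - gamma_i\<close>, and with \<open>s\<close> the sum of the coordinates of \<open>x\<close>, row \<open>i\<close>
  of \<open>A - lam I\<close>, multiplied by \<open>eps i\<close>, reads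
  \<open>p_i x_i^{m-1} + b_i s^{m-1} - (sum over js of d_{i,js} x^js)\<close> with \<open>p_i > 0\<close> and \<open>d \<ge> 0\<close>: a
  multiple of a power of the linear form \<open>s\<close> plus the row of an M-tensor. Leaving \<open>Psi_pair\<close> says that
  the pairs \<open>(p, d)\<close> satisfy Brauer's strict dominance condition. By Perron-Frobenius theory this
  gives positive weights \<open>kap\<close> with \<open>sum over js of d_{i,js} kap^js < p_i kap_i^{m-1}\<close> for all \<open>i\<close>
  (lemma \<open>exists_dominating_scaling\<close>).

  If all signs agree, the symmetric form \<open>sum over i of x_i (A x^{m-1})_i\<close> is a sum of
  \<open>m\<close>-th powers of linear forms and of a symmetric tensor of even order that is dominated by its
  positive diagonal, so it is positive. For mixed signs the signed
  combination \<open>sum over i of eps_i x_i (A x^{m-1})_i\<close> need not be positive, and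
  another test vector \<open>w\<close> has to replace \<open>x\<close>. It is found by moving from \<open>0\<close> to \<open>x\<close> along the
  vectors \<open>X(t)\<close> whose \<open>i\<close>-th coordinate is \<open>x_i\<close> clipped to the interval
  \<open>[- kap_i t, kap_i t]\<close>, and by setting \<open>dw = S(t)^{m-2} dX\<close>, where \<open>S(t)\<close> is the sum
  of the coordinates of \<open>X(t)\<close>. As \<open>m\<close> is even the density is nonnegative, so \<open>w_i x_i \<ge> 0\<close>, and
  \<open>(m - 1) * (sum over l of w_l) = s^{m-1}\<close>. Hence \<open>sum over i of b_i w_i s^{m-1}\<close> turns into a
  quadratic form in \<open>w\<close>. Along the path the coordinates that still move are, after division by \<open>kap\<close>,
  the largest ones, so dominance of their rows suffices to show that the difference between
  \<open>sum over i of eps_i w_i (A x^{m-1})_i\<close>, with the smallest admissible diagonal, and a positive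
  semidefinite quadratic form in \<open>w\<close> is nondecreasing. Symmetry of the tensor is used to
  express the derivative in the direction of a moving coordinate through the row of that coordinate
  alone. This is lemma \<open>weighted_signed_form_nonneg\<close>; lemma \<open>no_signed_eigenvector\<close> draws the
  conclusion.\<close>

section \<open>Homogeneous forms given by tensors\<close>

lemma finite_multi_indices: "finite (multi_indices k :: 'n::finite list set)"
  unfolding multi_indices_def using finite_lists_length_eq[of "UNIV :: 'n set" k] by simp

text \<open>The polynomial map \<open>T x^k\<close> with values in the reals: a row of a tensor of order \<open>k + 1\<close>, applied to
  \<open>x\<close>, has this shape, and so do its partial derivatives up to a factor.\<close>

definition hform :: "nat \<Rightarrow> ('n list \<Rightarrow> real) \<Rightarrow> ('n::finite \<Rightarrow> real) \<Rightarrow> real" where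
  "hform k T x = (\<Sum>js\<in>multi_indices k. T js * prod_list (map x js))"

lemma multi_indices_Suc: "multi_indices (Suc k) = (\<lambda>(l, js). l # js) ` (UNIV \<times> multi_indices k)"
  by (auto simp: multi_indices_def length_Suc_conv image_iff)

lemma hform_0: "hform 0 T x = T []"
  by (simp add: hform_def multi_indices_def)

lemma hform_Suc: "hform (Suc k) T x = (\<Sum>l\<in>UNIV. x l * hform k (\<lambda>js. T (l # js)) x)"
proof -
  have "hform (Suc k) T x = (\<Sum>(l, js)\<in>UNIV \<times> multi_indices k. T (l # js) * prod_list (map x (l # js)))"
    unfolding hform_def multi_indices_Suc
    by (subst sum.reindex) (auto simp: inj_on_def intro!: sum.cong)
  also have "\<dots> = (\<Sum>l\<in>UNIV. \<Sum>js\<in>multi_indices k. T (l # js) * prod_list (map x (l # js)))"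
    by (simp add: sum.cartesian_product)
  finally show ?thesis
    by (simp add: hform_def sum_distrib_left mult_ac)
qed

lemma hform_cong:
  "(\<And>js. length js = k \<Longrightarrow> T js = T' js) \<Longrightarrow> hform k T x = hform k T' x"
  by (auto simp: hform_def multi_indices_def intro!: sum.cong)

lemma hform_add: "hform k (\<lambda>js. T js + T' js) x = hform k T x + hform k T' x"
  by (simp add: hform_def sum.distrib algebra_simps)

lemma hform_diff: "hform k (\<lambda>js. T js - T' js) x = hform k T x - hform k T' x"
  by (simp add: hform_def sum_subtractf algebra_simps)

lemma hform_cmult: "hform k (\<lambda>js. c * T js) x = c * hform k T x"
  by (simp add: hform_def sum_distrib_left mult_ac)

lemma hform_const: "hform k (\<lambda>_. c) x = c * (\<Sum>l\<in>UNIV. x l) ^ k"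
  by (induction k) (auto simp: hform_0 hform_Suc sum_distrib_right mult_ac sum_distrib_left)

lemma hform_single: "hform k (\<lambda>js. if js = replicate k i then c else 0) x = c * x i ^ k"
proof -
  have "hform k (\<lambda>js. if js = replicate k i then c else 0) x
      = (\<Sum>js\<in>multi_indices k. if js = replicate k i then c * prod_list (map x js) else 0)"
    unfolding hform_def by (intro sum.cong) auto
  also have "\<dots> = c * x i ^ k"
    by (simp add: finite_multi_indices) (simp add: multi_indices_def prod_list_replicate)
  finally show ?thesis .
qed

lemma prod_list_abs_le:
  fixes x y :: "'a \<Rightarrow> real"
  assumes "\<And>i. \<bar>x i\<bar> \<le> y i"
  shows "\<bar>prod_list (map x js)\<bar> \<le> prod_list (map y js)"
proof (induction js)
  case (Cons a js)
  have "0 \<le> y a" using assms[of a] by linarith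
  then show ?case using Cons assms[of a] by (auto simp: abs_mult intro!: mult_mono)
qed auto

lemma hform_abs_le:
  assumes "\<And>js. length js = k \<Longrightarrow> \<bar>T js\<bar> \<le> D js" and "\<And>i. \<bar>x i\<bar> \<le> y i"
  shows "\<bar>hform k T x\<bar> \<le> hform k D y"
proof -
  have "\<bar>hform k T x\<bar> \<le> (\<Sum>js\<in>multi_indices k. \<bar>T js * prod_list (map x js)\<bar>)"
    unfolding hform_def by (rule sum_abs)
  also have "\<dots> \<le> hform k D y"
    unfolding hform_def
  proof (rule sum_mono)
    fix js :: "'a list" assume "js \<in> multi_indices k"
    then have "\<bar>T js\<bar> \<le> D js" using assms(1) by (simp add: multi_indices_def)
    then show "\<bar>T js * prod_list (map x js)\<bar> \<le> D js * prod_list (map y js)"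
      using prod_list_abs_le[OF assms(2), where js=js] by (auto simp: abs_mult intro!: mult_mono)
  qed
  finally show ?thesis .
qed

lemma prod_list_scale: "prod_list (map (\<lambda>i. t * y i) js) = (t::real) ^ length js * prod_list (map y js)"
  by (induction js) auto

lemma hform_scale: "hform k T (\<lambda>i. t * y i) = t ^ k * hform k T y"
  unfolding hform_def by (auto simp: prod_list_scale sum_distrib_left multi_indices_def intro!: sum.cong)

text \<open>By the symmetry of \<open>T\<close> each of the \<open>Suc k\<close> arguments contributes the same derivative.\<close>

lemma hform_has_derivative:
  assumes "\<And>js ks. length js = Suc k \<Longrightarrow> mset js = mset ks \<Longrightarrow> T js = T ks"
    and "\<And>l. (x l has_real_derivative x' l) (at t)"
  shows "((\<lambda>t. hform (Suc k) T (\<lambda>l. x l t)) has_real_derivative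
     (real (Suc k) * (\<Sum>l\<in>UNIV. x' l * hform k (\<lambda>js. T (l # js)) (\<lambda>l. x l t)))) (at t)"
  using assms(1)
proof (induction k arbitrary: T)
  case 0
  show ?case
    unfolding hform_Suc hform_0 by (auto intro!: derivative_eq_intros assms(2) sum.cong)
next
  case (Suc k)
  let ?X = "\<lambda>l. x l t"
  have IH: "((\<lambda>t. hform (Suc k) (\<lambda>js. T (l # js)) (\<lambda>l. x l t)) has_real_derivative
     (real (Suc k) * (\<Sum>l'\<in>UNIV. x' l' * hform k (\<lambda>js. T (l # l' # js)) ?X))) (at t)" for l
    by (rule Suc.IH) (auto intro!: Suc.prems)
  have sw: "hform k (\<lambda>js. T (l # l' # js)) ?X = hform k (\<lambda>js. T (l' # l # js)) ?X" for l l'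
    by (intro hform_cong Suc.prems) (auto simp: add_mset_commute)
  have "((\<lambda>t. hform (Suc (Suc k)) T (\<lambda>l. x l t)) has_real_derivative
      (\<Sum>l\<in>UNIV. x' l * hform (Suc k) (\<lambda>js. T (l # js)) ?X
        + ?X l * (real (Suc k) * (\<Sum>l'\<in>UNIV. x' l' * hform k (\<lambda>js. T (l # l' # js)) ?X)))) (at t)"
    unfolding hform_Suc[of "Suc k"]
    by (auto intro!: derivative_eq_intros assms(2) IH sum.cong simp: mult_ac)
  also have "(\<Sum>l\<in>UNIV. x' l * hform (Suc k) (\<lambda>js. T (l # js)) ?X
        + ?X l * (real (Suc k) * (\<Sum>l'\<in>UNIV. x' l' * hform k (\<lambda>js. T (l # l' # js)) ?X)))
     = (\<Sum>l\<in>UNIV. x' l * hform (Suc k) (\<lambda>js. T (l # js)) ?X)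
       + real (Suc k) * (\<Sum>l\<in>UNIV. \<Sum>l'\<in>UNIV. x' l' * (?X l * hform k (\<lambda>js. T (l' # l # js)) ?X))"
    by (simp add: sum.distrib sum_distrib_left sw[of _ ] mult_ac)
  also have "(\<Sum>l\<in>UNIV. \<Sum>l'\<in>UNIV. x' l' * (?X l * hform k (\<lambda>js. T (l' # l # js)) ?X))
     = (\<Sum>l'\<in>UNIV. x' l' * hform (Suc k) (\<lambda>js. T (l' # js)) ?X)"
    by (subst sum.swap) (simp add: hform_Suc[of k] sum_distrib_left)
  finally show ?case by (simp add: algebra_simps)
qed

lemma hform_continuous_on:
  assumes "\<And>l. continuous_on S (x l)"
  shows "continuous_on S (\<lambda>t. hform k T (\<lambda>l. x l t))"
  by (induction k arbitrary: T) (auto simp: hform_0 hform_Suc intro!: continuous_intros assms)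

lemma hform_off_diag:
  "hform (m - 1) (\<lambda>js. if js = replicate (m - 1) i then 0 else f js) (\<lambda>_. 1) = (\<Sum>js\<in>off_diag m i. f js)"
proof -
  have "hform (m - 1) (\<lambda>js. if js = replicate (m - 1) i then 0 else f js) (\<lambda>_. 1)
     = (\<Sum>js\<in>multi_indices (m - 1). if js = replicate (m - 1) i then 0 else f js)"
    unfolding hform_def by (intro sum.cong) (auto simp: map_replicate_const)
  also have "\<dots> = (\<Sum>js\<in>off_diag m i. f js)"
    unfolding off_diag_def by (intro sum.mono_neutral_cong_right finite_multi_indices) auto
  finally show ?thesis .
qed

lemma off_diag2_sum:
  fixes i j :: "'n::finite"
  assumes "i \<noteq> j" "2 \<le> m"
  shows "(\<Sum>js\<in>off_diag2 m i j. f js) = (\<Sum>js\<in>off_diag m j. f js) - (f (replicate (m - 1) i) :: real)"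
proof -
  have ne: "replicate (m - 1) i \<noteq> replicate (m - 1) j" using assms by (simp add: replicate_eq_replicate)
  have "off_diag m j = insert (replicate (m - 1) i) (off_diag2 m i j)"
    using ne by (auto simp: off_diag_def off_diag2_def multi_indices_def)
  moreover have "finite (off_diag2 m i j)" "replicate (m - 1) i \<notin> off_diag2 m i j"
    by (auto simp: off_diag2_def finite_multi_indices)
  ultimately show ?thesis by simp
qed

lemma diag_entry_Cons: "2 \<le> m \<Longrightarrow> diag_entry m A i = A (i # replicate (m - 1) i)"
  by (cases m) (auto simp: diag_entry_def)

section \<open>Clipping\<close>

definition clip :: "real \<Rightarrow> real \<Rightarrow> real" where
  "clip t z = max (- t) (min t z)"

lemma clip_abs_le: "0 \<le> t \<Longrightarrow> \<bar>clip t z\<bar> \<le> t"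
  by (auto simp: clip_def)

lemma clip_above: "\<bar>z\<bar> \<le> t \<Longrightarrow> clip t z = z"
  by (auto simp: clip_def)

lemma clip_below: "0 \<le> t \<Longrightarrow> t \<le> \<bar>z\<bar> \<Longrightarrow> clip t z = sgn z * t"
  by (auto simp: clip_def sgn_real_def)

lemma clip_zero: "clip 0 z = 0"
  by (auto simp: clip_def)

lemma continuous_on_clip: "continuous_on S (\<lambda>t. clip t z)"
  unfolding clip_def by (intro continuous_intros)

text \<open>A clipped coordinate moves with unit speed until it reaches its target \<open>z\<close> and then stops; the same
  holds for any function that is stopped at a time \<open>a\<close>.\<close>

lemma clip_has_derivative:
  assumes "0 < t" "t \<noteq> \<bar>z\<bar>"
  shows "((\<lambda>t. clip t z) has_real_derivative (if t < \<bar>z\<bar> then sgn z else 0)) (at t)"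
proof (cases "t < \<bar>z\<bar>")
  case True
  have "((\<lambda>t. sgn z * t) has_real_derivative sgn z) (at t)"
    by (auto intro!: derivative_eq_intros)
  moreover have "eventually (\<lambda>u. u \<in> {0<..<\<bar>z\<bar>}) (nhds t)"
    using assms True by (intro eventually_nhds_in_open) auto
  then have "eventually (\<lambda>u. clip u z = sgn z * u) (nhds t)"
    by eventually_elim (simp add: clip_below)
  ultimately show ?thesis using True by (subst DERIV_cong_ev[OF refl _ refl]) auto
next
  case False
  have "((\<lambda>t. z) has_real_derivative 0) (at t)" by simp
  moreover have "eventually (\<lambda>u. u \<in> {\<bar>z\<bar><..}) (nhds t)"
    using assms False by (intro eventually_nhds_in_open) auto
  then have "eventually (\<lambda>u. clip u z = z) (nhds t)"
    by eventually_elim (simp add: clip_above)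
  ultimately show ?thesis using False by (subst DERIV_cong_ev[OF refl _ refl]) auto
qed

lemma stopped_has_derivative:
  assumes "t \<noteq> a" and "(f has_real_derivative f') (at t)"
  shows "((\<lambda>t. f (min t a)) has_real_derivative (if t < a then f' else 0)) (at t)"
proof (cases "t < a")
  case True
  have "eventually (\<lambda>u. u \<in> {..<a}) (nhds t)"
    using True by (intro eventually_nhds_in_open) auto
  then have "eventually (\<lambda>u. f (min u a) = f u) (nhds t)"
    by eventually_elim (simp add: min_def)
  then show ?thesis using True assms(2) by (subst DERIV_cong_ev[OF refl _ refl]) auto
next
  case False
  have "eventually (\<lambda>u. u \<in> {a<..}) (nhds t)"
    using assms False by (intro eventually_nhds_in_open) auto
  then have "eventually (\<lambda>u. f (min u a) = f a) (nhds t)"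
    by eventually_elim (simp add: min_def)
  then show ?thesis using False by (subst DERIV_cong_ev[OF refl _ refl]) auto
qed

text \<open>Each coordinate of the path has a kink where it stops, so finitely many points must be exempt from
  differentiability.\<close>

lemma nonneg_derivative_imp_le:
  fixes f :: "real \<Rightarrow> real"
  assumes "finite K" "a \<le> b" "continuous_on {a..b} f"
    and "\<And>t. t \<in> {a<..<b} - K \<Longrightarrow> (f has_real_derivative f' t) (at t)"
    and "\<And>t. t \<in> {a<..<b} - K \<Longrightarrow> 0 \<le> f' t"
  shows "f a \<le> f b"
proof -
  have "(f' has_integral (f b - f a)) {a..b}"
    using assms by (intro fundamental_theorem_of_calculus_interior_strong[of K])
      (auto simp: has_real_derivative_iff_has_vector_derivative[symmetric])
  then have "((\<lambda>t. if t \<in> {a,b} \<union> K then 0 else f' t) has_integral (f b - f a)) {a..b}"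
    by (rule has_integral_spike_finite[of "{a,b} \<union> K", rotated 2]) (use assms in auto)
  then have "0 \<le> f b - f a"
    by (rule has_integral_nonneg) (use assms(5) in auto)
  then show ?thesis by simp
qed

section \<open>A positive semidefinite kernel\<close>

text \<open>The minimum is the covariance kernel of Brownian motion. Here the proof peels off the smallest value
  \<open>c\<close> of \<open>b\<close>, which contributes \<open>c\<close> times the square of the sum of \<open>v\<close>, and reduces to one index
  fewer.\<close>

lemma min_kernel_nonneg:
  fixes b v :: "'a \<Rightarrow> real"
  assumes "finite S" and "\<And>i. i \<in> S \<Longrightarrow> 0 \<le> b i"
  shows "0 \<le> (\<Sum>i\<in>S. \<Sum>l\<in>S. min (b i) (b l) * v i * v l)"
  using assms
proof (induction "card S" arbitrary: S b)
  case 0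
  then show ?case by simp
next
  case (Suc n)
  then have "S \<noteq> {}" by auto
  define c where "c = Min (b ` S)"
  have "c \<in> b ` S" unfolding c_def using Suc \<open>S \<noteq> {}\<close> by (intro Min_in) auto
  then obtain a where a: "a \<in> S" "b a = c" by auto
  have le: "c \<le> b i" if "i \<in> S" for i unfolding c_def using Suc that by auto
  let ?b = "\<lambda>i. b i - c"
  have "(\<Sum>i\<in>S. \<Sum>l\<in>S. min (b i) (b l) * v i * v l)
      = (\<Sum>i\<in>S. \<Sum>l\<in>S. c * (v i * v l) + min (?b i) (?b l) * v i * v l)"
    by (intro sum.cong refl) (auto simp: min_def algebra_simps)
  also have "\<dots> = c * (\<Sum>i\<in>S. v i)^2 + (\<Sum>i\<in>S. \<Sum>l\<in>S. min (?b i) (?b l) * v i * v l)"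
    by (simp add: sum.distrib sum_distrib_left[symmetric] power2_eq_square sum_product)
  also have "(\<Sum>i\<in>S. \<Sum>l\<in>S. min (?b i) (?b l) * v i * v l)
      = (\<Sum>i\<in>S-{a}. \<Sum>l\<in>S-{a}. min (?b i) (?b l) * v i * v l)"
  proof -
    have z: "min (?b i) (?b l) = 0" if "i \<in> S" "l \<in> S" "i = a \<or> l = a" for i l
      using that le[of i] le[of l] a by auto
    have "(\<Sum>i\<in>S. \<Sum>l\<in>S. min (?b i) (?b l) * v i * v l)
       = (\<Sum>i\<in>S-{a}. \<Sum>l\<in>S. min (?b i) (?b l) * v i * v l)"
      using Suc a z by (intro sum.mono_neutral_right) (auto intro!: sum.neutral)
    also have "\<dots> = (\<Sum>i\<in>S-{a}. \<Sum>l\<in>S-{a}. min (?b i) (?b l) * v i * v l)"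
      using Suc a z by (intro sum.cong sum.mono_neutral_right) auto
    finally show ?thesis .
  qed
  finally have eq: "(\<Sum>i\<in>S. \<Sum>l\<in>S. min (b i) (b l) * v i * v l)
     = c * (\<Sum>i\<in>S. v i)^2 + (\<Sum>i\<in>S-{a}. \<Sum>l\<in>S-{a}. min (?b i) (?b l) * v i * v l)" .
  have "0 \<le> (\<Sum>i\<in>S-{a}. \<Sum>l\<in>S-{a}. min (?b i) (?b l) * v i * v l)"
    using Suc a le by (intro Suc.hyps(1)) auto
  moreover have "0 \<le> c" using Suc.prems(2)[OF a(1)] a by simp
  ultimately show ?case unfolding eq by simp
qed

section \<open>The test vector for rows of mixed sign\<close>

text \<open>The contribution of one moving coordinate \<open>l\<close> to the derivative along the path, multiplied by the sign
  \<open>h\<close> of that coordinate. The last summand vanishes since \<open>P = N * V\<close> will hold for \<open>P = S^{m-1}\<close>,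
  \<open>N = m - 1\<close> and \<open>V\<close> the sum of the test vector.\<close>

lemma rate_algebra:
  fixes h :: real
  assumes "h * u = u'" "h * (a * c) = w'"
  shows "h * (\<psi> * (q * u + (b * P - D)) + N * (q * a * c + (S - b * \<psi> * V)))
    = \<psi> * (q * u' - h * D) + N * (q * w' + h * S) + h * b * \<psi> * (P - N * V)"
  unfolding assms[symmetric] by (simp add: algebra_simps)

text \<open>The test vector \<open>w\<close>. The tensor \<open>T\<close> has order \<open>r + 2\<close>, and the number \<open>q i\<close> is the smallest diagonal
  supplement for which row \<open>i\<close> is dominated in the weights \<open>kap\<close>. The path ends at \<open>x\<close>, the functional \<open>E\<close>
  below starts at \<open>0\<close>, and its derivative is a sum over the moving coordinates \<open>l\<close> of quantities that
  only involve row \<open>l\<close>. In that row the terms with \<open>b l\<close> cancel because of the relation between \<open>w\<close> and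
  the sum of \<open>x\<close>; what remains is controlled by \<open>q l\<close>, since at time \<open>t\<close> the modulus of coordinate \<open>i\<close> is at most
  \<open>t * kap i\<close>, with equality for the moving coordinate \<open>l\<close>.\<close>

lemma weighted_signed_form_nonneg:
  fixes T :: "'n::finite list \<Rightarrow> real" and eps b kap q x :: "'n \<Rightarrow> real"
  assumes r: "even r"
    and sym: "\<And>js ks. length js = Suc (Suc r) \<Longrightarrow> mset js = mset ks \<Longrightarrow> T js = T ks"
    and eps: "\<And>i. eps i = 1 \<or> eps i = -1"
    and b: "\<And>i. 0 \<le> b i"
    and bound: "\<And>i js. length js = Suc r \<Longrightarrow> eps i * T (i # js) \<le> b i"
    and kap: "\<And>i. 0 < kap i"
    and q: "\<And>i. q i * kap i ^ Suc r = hform (Suc r) (\<lambda>js. b i - eps i * T (i # js)) kap"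
  shows "\<exists>w. (\<forall>i. 0 \<le> w i * x i) \<and> (\<forall>i. x i = 0 \<longrightarrow> w i = 0) \<and>
      real (Suc r) * (\<Sum>i\<in>UNIV. w i) = (\<Sum>i\<in>UNIV. x i) ^ Suc r \<and>
      0 \<le> (\<Sum>i\<in>UNIV. w i * (q i * x i ^ Suc r + eps i * hform (Suc r) (\<lambda>js. T (i # js)) x))"
proof -
  define z where "z i = x i / kap i" for i
  define X where "X i t = kap i * clip t (z i)" for i t
  define s where "s t = (\<Sum>i\<in>UNIV. X i t)" for t
  define \<psi> where "\<psi> t = s t ^ r" for t
  define R where "R = 1 + (\<Sum>i\<in>UNIV. \<bar>z i\<bar>)"
  define \<phi> where "\<phi> t = integral {0..t} \<psi>" for t
  define v where "v i t = kap i * (sgn (z i) * \<phi> (min t \<bar>z i\<bar>))" for i t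
  \<comment> \<open>The quadratic form to be compared with: rows of opposite sign are decoupled, and within one sign the
    kernel must stay below both \<open>b i\<close> and \<open>b l\<close> and above the entries that the two rows share.\<close>
  define c where "c i l = (if eps i = eps l then min (b i) (b l) else 0)" for i l
  define d where "d i js = b i - eps i * T (i # js)" for i js
  define H where "H i t = hform (Suc r) (\<lambda>js. T (i # js)) (\<lambda>l. X l t)" for i t
  define H2 where "H2 i l t = hform r (\<lambda>js. T (i # l # js)) (\<lambda>l. X l t)" for i l t
  \<comment> \<open>\<open>H\<close> and \<open>H2\<close> are the rows of the tensor along the path and their partial derivatives up to the factor
    \<open>r + 1\<close>.\<close>
  define E where "E t = (\<Sum>i\<in>UNIV. v i t * (q i * X i t ^ Suc r + eps i * H i t))
      - real (Suc r) * (\<Sum>i\<in>UNIV. \<Sum>l\<in>UNIV. c i l * v i t * v l t)" for t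
  \<comment> \<open>The velocity of the \<open>i\<close>-th coordinate before scaling by \<open>kap i\<close>; \<open>K\<close> below collects the stopping times.\<close>
  define g where "g i t = (if t < \<bar>z i\<bar> then sgn (z i) else 0)" for i t
  define K where "K = (\<lambda>i. \<bar>z i\<bar>) ` UNIV"
  have K: "finite K" unfolding K_def by simp
  have zR: "\<bar>z i\<bar> < R" for i
  proof -
    have "\<bar>z i\<bar> \<le> (\<Sum>i\<in>UNIV. \<bar>z i\<bar>)" by (rule member_le_sum) auto
    then show ?thesis unfolding R_def by simp
  qed
  have R: "0 < R" unfolding R_def by (smt (verit) sum_nonneg abs_ge_zero)
  have c_sym: "c i l = c l i" for i l by (auto simp: c_def min.commute)
  have c_psd: "0 \<le> (\<Sum>i\<in>UNIV. \<Sum>l\<in>UNIV. c i l * w i * w l)" for w :: "'n \<Rightarrow> real"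
  proof -
    let ?P = "{i. eps i = 1}"
    have em: "eps i = -1" if "eps i \<noteq> 1" for i using eps that by blast
    have "(\<Sum>i\<in>UNIV. \<Sum>l\<in>UNIV. c i l * w i * w l)
       = (\<Sum>i\<in>?P. \<Sum>l\<in>UNIV. c i l * w i * w l) + (\<Sum>i\<in>-?P. \<Sum>l\<in>UNIV. c i l * w i * w l)"
      by (subst sum.union_disjoint[symmetric]) (auto intro!: sum.cong)
    also have "(\<Sum>i\<in>?P. \<Sum>l\<in>UNIV. c i l * w i * w l) = (\<Sum>i\<in>?P. \<Sum>l\<in>?P. min (b i) (b l) * w i * w l)"
      by (intro sum.cong refl sum.mono_neutral_cong_right) (auto simp: c_def)
    also have "(\<Sum>i\<in>-?P. \<Sum>l\<in>UNIV. c i l * w i * w l) = (\<Sum>i\<in>-?P. \<Sum>l\<in>-?P. min (b i) (b l) * w i * w l)"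
      by (intro sum.cong refl sum.mono_neutral_cong_right) (auto simp: c_def em)
    finally show ?thesis
      using min_kernel_nonneg[of ?P b w] min_kernel_nonneg[of "-?P" b w] b by simp
  qed
  have X_cont: "continuous_on S (X i)" for S i
    unfolding X_def by (intro continuous_intros continuous_on_clip)
  have psi_cont: "continuous_on S \<psi>" for S
    unfolding \<psi>_def s_def by (intro continuous_intros X_cont)
  have psi_nn: "0 \<le> \<psi> t" for t unfolding \<psi>_def using r by (rule zero_le_even_power)
  have psi_int: "\<psi> integrable_on {a..b}" for a b
    by (intro integrable_continuous_interval psi_cont)
  have phi0: "\<phi> 0 = 0" unfolding \<phi>_def by simp
  have phi_mono: "\<phi> t \<le> \<phi> t'" if "t \<le> t'" for t t'
    unfolding \<phi>_def using that by (intro integral_subset_le psi_int) (auto simp: psi_nn)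
  have phi_nn: "0 \<le> \<phi> t" if "0 \<le> t" for t
    using phi_mono[OF that] phi0 by simp
  have phi_cont: "continuous_on {0..R} \<phi>"
    unfolding \<phi>_def by (intro indefinite_integral_continuous_1 psi_int)
  have phi_der: "(\<phi> has_real_derivative \<psi> t) (at t)" if "0 < t" "t < R" for t
  proof -
    have "(\<phi> has_real_derivative \<psi> t) (at t within {0..R})"
      unfolding \<phi>_def using that by (intro integral_has_real_derivative psi_cont) auto
    then show ?thesis using that by (simp add: at_within_Icc_at)
  qed
  have X_der: "(X i has_real_derivative kap i * g i t) (at t)" if "0 < t" "t \<notin> K" for i t
    unfolding X_def g_def using that by (intro DERIV_cmult clip_has_derivative) (auto simp: K_def)
  have v_der: "(v i has_real_derivative kap i * \<psi> t * g i t) (at t)" if "0 < t" "t < R" "t \<notin> K" for i t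
  proof -
    have "((\<lambda>t. \<phi> (min t \<bar>z i\<bar>)) has_real_derivative (if t < \<bar>z i\<bar> then \<psi> t else 0)) (at t)"
      using that by (intro stopped_has_derivative phi_der) (auto simp: K_def)
    then have "(v i has_real_derivative kap i * (sgn (z i) * (if t < \<bar>z i\<bar> then \<psi> t else 0))) (at t)"
      unfolding v_def by (intro DERIV_cmult)
    then show ?thesis by (rule DERIV_cong) (simp add: g_def)
  qed
  have v_cont: "continuous_on {0..R} (v i)" for i
    unfolding v_def
    by (intro continuous_intros continuous_on_compose2[OF phi_cont]) (use zR in \<open>auto simp: min_def\<close>)
  have s_der: "(s has_real_derivative (\<Sum>i\<in>UNIV. kap i * g i t)) (at t)" if "0 < t" "t \<notin> K" for t
    unfolding s_def by (intro DERIV_sum X_der that)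
  have v0: "v i 0 = 0" for i unfolding v_def by (simp add: phi0)
  have s0: "s 0 = 0" unfolding s_def X_def by (simp add: clip_zero)
  have v_sum: "real (Suc r) * (\<Sum>i\<in>UNIV. v i t) = s t ^ Suc r" if t: "0 \<le> t" "t \<le> R" for t
  proof -
    let ?f = "\<lambda>t. real (Suc r) * (\<Sum>i\<in>UNIV. v i t) - s t ^ Suc r"
    have f_cont: "continuous_on {0..t} ?f"
      by (intro continuous_intros continuous_on_subset[OF v_cont]) (use that in \<open>auto simp: s_def intro!: continuous_intros X_cont\<close>)
    have f_der: "(?f has_real_derivative 0) (at u)" if "u \<in> {0<..<t} - K" for u
    proof -
      have u: "0 < u" "u < R" "u \<notin> K" using that t by auto
      have "(?f has_real_derivative (real (Suc r) * (\<Sum>i\<in>UNIV. kap i * \<psi> u * g i u)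
          - real (Suc r) * s u ^ r * (\<Sum>i\<in>UNIV. kap i * g i u))) (at u)"
        by (intro DERIV_diff DERIV_cmult DERIV_sum v_der u DERIV_cong[OF DERIV_power_Suc[OF s_der]])
          simp
      then show ?thesis
        by (rule DERIV_cong) (simp add: \<psi>_def sum_distrib_left mult_ac)
    qed
    have "?f 0 \<le> ?f t" by (rule nonneg_derivative_imp_le[OF K t(1) f_cont, of "\<lambda>_. 0"]) (use f_der in auto)
    moreover have "- ?f 0 \<le> - ?f t"
    proof (rule nonneg_derivative_imp_le[OF K t(1) continuous_on_minus[OF f_cont]])
      show "((\<lambda>t. - ?f t) has_real_derivative - 0) (at u)" if "u \<in> {0<..<t} - K" for u
        by (rule DERIV_minus[OF f_der[OF that]])
    qed simp
    ultimately have "?f t = ?f 0" by simp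
    then show ?thesis by (simp add: v0 s0)
  qed
  have d_nn: "0 \<le> d i js" if "length js = Suc r" for i js
    using bound[OF that] by (simp add: d_def)
  have q': "hform (Suc r) (d i) kap = q i * kap i ^ Suc r" for i using q[of i] by (simp add: d_def[abs_def])
  have v_abs: "\<bar>v i t\<bar> \<le> kap i * \<phi> t" if "0 \<le> t" for i t
  proof -
    have "\<bar>sgn (z i)\<bar> * \<bar>\<phi> (min t \<bar>z i\<bar>)\<bar> \<le> 1 * \<phi> t"
      using phi_nn[of "min t \<bar>z i\<bar>"] phi_mono[of "min t \<bar>z i\<bar>" t] that
      by (intro mult_mono) (auto simp: sgn_real_def)
    then show ?thesis unfolding v_def using kap[of i] by (simp add: abs_mult)
  qed
  have X_abs: "\<bar>X i t\<bar> \<le> t * kap i" if "0 \<le> t" for i t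
    unfolding X_def using clip_abs_le[OF that, of "z i"] kap[of i] by (simp add: abs_mult mult.commute)
  \<comment> \<open>After the terms \<open>b l * \<psi>\<close> have been split off, row \<open>i\<close> differentiated in direction \<open>l\<close> is, by symmetry,
    expressed through the entries \<open>d l\<close> of row \<open>l\<close> alone: with unchanged modulus if the signs differ,
    and with modulus at most \<open>d l\<close> if they agree, because \<open>b l - min (b i) (b l)\<close> is at most \<open>d l\<close>.\<close>
  define G where "G l i t = hform r (\<lambda>js. if eps i = eps l then 2 * (b l - min (b i) (b l)) - d l (i # js) else d l (i # js)) (\<lambda>l. X l t)" for l i t
  have row: "eps l * H l t = b l * s t ^ Suc r - hform (Suc r) (d l) (\<lambda>l. X l t)" for l t
    unfolding H_def d_def hform_diff hform_const hform_cmult s_def by simp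
  have swp: "T (i # l # js) = T (l # i # js)" if "length js = r" for i l js
    using that by (intro sym) (auto simp: add_mset_commute)
  have row2: "eps i * H2 i l t - 2 * \<psi> t * c i l = G l i t - b l * \<psi> t" for i l t
  proof -
    have 1: "eps i * H2 i l t = hform r (\<lambda>js. eps i * T (l # i # js)) (\<lambda>l. X l t)"
      unfolding H2_def hform_cmult[symmetric] by (intro hform_cong) (simp add: swp)
    have 2: "\<psi> t * y = hform r (\<lambda>_. y) (\<lambda>l. X l t)" for y
      by (simp add: hform_const \<psi>_def s_def)
    have "eps i * H2 i l t - 2 * \<psi> t * c i l + b l * \<psi> t
      = hform r (\<lambda>js. eps i * T (l # i # js)) (\<lambda>l. X l t) + \<psi> t * (b l - 2 * c i l)"
      by (simp add: 1 algebra_simps)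
    also have "\<dots> = hform r (\<lambda>js. eps i * T (l # i # js) + (b l - 2 * c i l)) (\<lambda>l. X l t)"
      by (simp only: 2 hform_add)
    also have "\<dots> = G l i t"
      unfolding G_def using eps[of i] eps[of l]
      by (intro hform_cong) (auto simp: d_def c_def algebra_simps)
    finally show ?thesis by simp
  qed
  have G_abs: "\<bar>G l i t\<bar> \<le> t ^ r * hform r (\<lambda>js. d l (i # js)) kap" if "0 \<le> t" for l i t
  proof -
    have "\<bar>G l i t\<bar> \<le> hform r (\<lambda>js. d l (i # js)) (\<lambda>i. t * kap i)"
      unfolding G_def
    proof (rule hform_abs_le)
      fix js :: "'n list" assume js: "length js = r"
      have n: "0 \<le> d l (i # js)" using js by (intro d_nn) simp
      have m: "b l - min (b i) (b l) \<le> d l (i # js)" if e: "eps i = eps l"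
      proof -
        have "eps l * T (l # i # js) \<le> b i"
          using bound[of "l # js" i] swp[OF js, of i l] e js by simp
        then show ?thesis using n by (auto simp: d_def min_def)
      qed
      show "\<bar>if eps i = eps l then 2 * (b l - min (b i) (b l)) - d l (i # js) else d l (i # js)\<bar> \<le> d l (i # js)"
        using n m by (auto simp: abs_le_iff)
    qed (use X_abs[OF that] in auto)
    then show ?thesis by (simp add: hform_scale)
  qed
  \<comment> \<open>The coefficient of the velocity of coordinate \<open>l\<close> in the derivative of \<open>E\<close>.\<close>
  define rate where "rate l t = \<psi> t * (q l * X l t ^ Suc r + eps l * H l t)
      + real (Suc r) * (q l * v l t * X l t ^ r + (\<Sum>i\<in>UNIV. v i t * (eps i * H2 i l t - 2 * \<psi> t * c i l)))" for l t
  have rate_nn: "0 \<le> g l t * rate l t" if t: "0 < t" "t < R" for l t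
  proof (cases "t < \<bar>z l\<bar>")
    case False
    then show ?thesis by (simp add: g_def)
  next
    case True
    define h where "h = sgn (z l)"
    have gh: "g l t = h" using True by (simp add: g_def h_def)
    have h: "h * h = 1" using True t by (auto simp: h_def sgn_real_def)
    then have hr: "h ^ r = 1" using r by (metis dvd_def power_mult power2_eq_square power_one)
    have Xl: "X l t = h * (kap l * t)" using clip_below[of t "z l"] True t by (simp add: X_def h_def)
    have vl: "v l t = h * (kap l * \<phi> t)" using True by (simp add: v_def h_def min_def)
    define D where "D = hform (Suc r) (d l) (\<lambda>l. X l t)"
    define S where "S = (\<Sum>i\<in>UNIV. v i t * G l i t)"
    have Sum: "(\<Sum>i\<in>UNIV. v i t * (eps i * H2 i l t - 2 * \<psi> t * c i l)) = S - b l * \<psi> t * (\<Sum>i\<in>UNIV. v i t)"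
      unfolding row2 S_def by (simp add: algebra_simps sum_subtractf sum_distrib_left)
    have "h * (h * (kap l * t)) ^ Suc r = (kap l * t) ^ Suc r"
      by (simp add: power_mult_distrib hr h mult.assoc[symmetric])
    moreover have "h * ((h * (kap l * \<phi> t)) * (h * (kap l * t)) ^ r) = (kap l * \<phi> t) * (kap l * t) ^ r"
      by (simp add: power_mult_distrib hr h mult.assoc[symmetric])
    ultimately have "g l t * rate l t = \<psi> t * (q l * (kap l * t) ^ Suc r - h * D)
       + real (Suc r) * (q l * ((kap l * \<phi> t) * (kap l * t) ^ r) + h * S)
       + h * b l * \<psi> t * (s t ^ Suc r - real (Suc r) * (\<Sum>i\<in>UNIV. v i t))"
      unfolding gh rate_def Xl vl Sum row D_def[symmetric] by (rule rate_algebra)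
    also have "\<dots> = \<psi> t * (q l * (kap l * t) ^ Suc r - h * D)
       + real (Suc r) * (q l * ((kap l * \<phi> t) * (kap l * t) ^ r) + h * S)"
      using v_sum[of t] t by simp
    also have "\<dots> \<ge> 0"
    proof -
      have h1: "\<bar>h\<bar> = 1" using h by (metis abs_mult_self_eq abs_one abs_mult power2_eq_square abs_square_eq_1)
      have "\<bar>D\<bar> \<le> hform (Suc r) (d l) (\<lambda>i. t * kap i)"
        unfolding D_def by (rule hform_abs_le) (use X_abs d_nn t in auto)
      also have "\<dots> = q l * (kap l * t) ^ Suc r"
        by (simp only: hform_scale q') (simp add: power_mult_distrib)
      finally have D: "\<bar>h * D\<bar> \<le> q l * (kap l * t) ^ Suc r" by (simp add: abs_mult h1)
      have "\<bar>S\<bar> \<le> (\<Sum>i\<in>UNIV. \<bar>v i t * G l i t\<bar>)" unfolding S_def by (rule sum_abs)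
      also have "\<dots> \<le> (\<Sum>i\<in>UNIV. (kap i * \<phi> t) * (t ^ r * hform r (\<lambda>js. d l (i # js)) kap))"
      proof (rule sum_mono)
        fix i
        show "\<bar>v i t * G l i t\<bar> \<le> (kap i * \<phi> t) * (t ^ r * hform r (\<lambda>js. d l (i # js)) kap)"
          unfolding abs_mult using v_abs[of t i] G_abs[of t l i] t kap[of i] phi_nn[of t]
          by (intro mult_mono) auto
      qed
      also have "\<dots> = \<phi> t * t ^ r * hform (Suc r) (d l) kap"
        by (simp add: hform_Suc sum_distrib_left mult_ac)
      also have "\<dots> = q l * (kap l * \<phi> t) * (kap l * t) ^ r"
        by (simp only: q') (simp add: power_mult_distrib)
      finally have S: "\<bar>h * S\<bar> \<le> q l * (kap l * \<phi> t) * (kap l * t) ^ r" by (simp add: abs_mult h1)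
      have 1: "0 \<le> q l * (kap l * t) ^ Suc r - h * D"
        using D by (simp only: abs_le_iff diff_ge_0_iff_ge)
      have 2: "0 \<le> q l * ((kap l * \<phi> t) * (kap l * t) ^ r) + h * S"
        using S unfolding mult.assoc[symmetric] by linarith
      show ?thesis
        by (intro add_nonneg_nonneg mult_nonneg_nonneg[OF psi_nn 1] mult_nonneg_nonneg[OF _ 2]) simp
    qed
    finally show ?thesis .
  qed
  have E_der: "(E has_real_derivative (\<Sum>l\<in>UNIV. kap l * (g l t * rate l t))) (at t)"
    if t: "t \<in> {0<..<R} - K" for t
  proof -
    have t': "0 < t" "t < R" "t \<notin> K" using t by auto
    have H_der: "(H i has_real_derivative (real (Suc r) * (\<Sum>l\<in>UNIV. (kap l * g l t) * H2 i l t))) (at t)" for i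
      unfolding H_def H2_def by (intro hform_has_derivative X_der t') (auto intro!: sym)
    have "(E has_real_derivative
        ((\<Sum>i\<in>UNIV. kap i * \<psi> t * g i t * (q i * X i t ^ Suc r + eps i * H i t)
            + (q i * (real (Suc r) * X i t ^ r * (kap i * g i t))
               + eps i * (real (Suc r) * (\<Sum>l\<in>UNIV. (kap l * g l t) * H2 i l t))) * v i t)
          - real (Suc r) * (\<Sum>i\<in>UNIV. \<Sum>l\<in>UNIV. c i l * (kap i * \<psi> t * g i t) * v l t
              + kap l * \<psi> t * g l t * (c i l * v i t)))) (at t)"
      unfolding E_def
      by (intro DERIV_diff DERIV_sum DERIV_mult DERIV_add DERIV_cmult v_der t' H_der
          DERIV_cong[OF DERIV_power_Suc[OF X_der]]) simp
    then show ?thesis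
    proof (rule DERIV_cong)
      have 1: "(\<Sum>i\<in>UNIV. \<Sum>l\<in>UNIV. c i l * (kap i * \<psi> t * g i t) * v l t + kap l * \<psi> t * g l t * (c i l * v i t))
         = (\<Sum>l\<in>UNIV. kap l * g l t * (\<Sum>i\<in>UNIV. v i t * (2 * \<psi> t * c i l)))"
      proof -
        have "(\<Sum>i\<in>UNIV. \<Sum>l\<in>UNIV. c i l * (kap i * \<psi> t * g i t) * v l t)
           = (\<Sum>l\<in>UNIV. \<Sum>i\<in>UNIV. kap l * \<psi> t * g l t * (c i l * v i t))"
          by (intro sum.cong refl) (simp add: c_sym[of _ ] mult_ac)
        moreover have "(\<Sum>i\<in>UNIV. \<Sum>l\<in>UNIV. kap l * \<psi> t * g l t * (c i l * v i t))
           = (\<Sum>l\<in>UNIV. \<Sum>i\<in>UNIV. kap l * \<psi> t * g l t * (c i l * v i t))"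
          by (rule sum.swap)
        ultimately show ?thesis
          by (simp add: sum.distrib sum_distrib_left mult_ac)
      qed
      have 2: "(\<Sum>i\<in>UNIV. eps i * (real (Suc r) * (\<Sum>l\<in>UNIV. (kap l * g l t) * H2 i l t)) * v i t)
         = real (Suc r) * (\<Sum>l\<in>UNIV. kap l * g l t * (\<Sum>i\<in>UNIV. v i t * (eps i * H2 i l t)))"
        unfolding sum_distrib_left sum_distrib_right by (subst sum.swap) (simp add: mult_ac)
      define SH where "SH l = (\<Sum>i\<in>UNIV. v i t * (eps i * H2 i l t))" for l
      define SC where "SC l = (\<Sum>i\<in>UNIV. v i t * (2 * \<psi> t * c i l))" for l
      have 3: "kap l * (g l t * rate l t) = kap l * \<psi> t * g l t * (q l * X l t ^ Suc r + eps l * H l t)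
          + q l * (real (Suc r) * X l t ^ r * (kap l * g l t)) * v l t
          + real (Suc r) * (kap l * g l t * SH l) - real (Suc r) * (kap l * g l t * SC l)" for l
      proof -
        have "(\<Sum>i\<in>UNIV. v i t * (eps i * H2 i l t - 2 * \<psi> t * c i l)) = SH l - SC l"
          by (simp only: SH_def SC_def right_diff_distrib sum_subtractf)
        then show ?thesis unfolding rate_def by (simp only:) (simp add: algebra_simps)
      qed
      show "(\<Sum>i\<in>UNIV. kap i * \<psi> t * g i t * (q i * X i t ^ Suc r + eps i * H i t)
            + (q i * (real (Suc r) * X i t ^ r * (kap i * g i t))
               + eps i * (real (Suc r) * (\<Sum>l\<in>UNIV. (kap l * g l t) * H2 i l t))) * v i t)
          - real (Suc r) * (\<Sum>i\<in>UNIV. \<Sum>l\<in>UNIV. c i l * (kap i * \<psi> t * g i t) * v l t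
              + kap l * \<psi> t * g l t * (c i l * v i t))
         = (\<Sum>l\<in>UNIV. kap l * (g l t * rate l t))"
        by (subst 1, unfold 3 distrib_right[of _ _ "v _ t"] sum.distrib sum_subtractf 2)
          (simp only: SH_def[symmetric] SC_def[symmetric] sum_distrib_left[symmetric])
    qed
  qed
  have E_cont: "continuous_on {0..R} E"
    unfolding E_def H_def by (intro continuous_intros v_cont X_cont hform_continuous_on)
  have "E 0 \<le> E R"
  proof (rule nonneg_derivative_imp_le[OF K less_imp_le[OF R] E_cont E_der])
    show "0 \<le> (\<Sum>l\<in>UNIV. kap l * (g l t * rate l t))" if "t \<in> {0<..<R} - K" for t
    proof (rule sum_nonneg)
      fix l
      have "0 \<le> g l t * rate l t" using that by (intro rate_nn) auto
      then show "0 \<le> kap l * (g l t * rate l t)" using kap[of l] by simp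
    qed
  qed
  moreover have "E 0 = 0" by (simp add: E_def v0)
  ultimately have ER: "0 \<le> E R" by simp
  have XR: "X i R = x i" for i
    using zR[of i] kap[of i] by (simp add: X_def clip_above z_def)
  show ?thesis
  proof (intro exI[of _ "\<lambda>i. v i R"] conjI allI impI)
    fix i
    have "v i R = kap i * (sgn (x i) * \<phi> \<bar>z i\<bar>)"
      using zR[of i] kap[of i] by (simp add: v_def z_def sgn_divide min_def)
    then show "0 \<le> v i R * x i" "x i = 0 \<Longrightarrow> v i R = 0"
      using kap[of i] phi_nn[of "\<bar>z i\<bar>"] by (auto simp: sgn_real_def zero_le_mult_iff mult_le_0_iff)
  next
    show "real (Suc r) * (\<Sum>i\<in>UNIV. v i R) = (\<Sum>i\<in>UNIV. x i) ^ Suc r"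
      using v_sum[of R] R by (simp add: s_def XR)
  next
    have "0 \<le> real (Suc r) * (\<Sum>i\<in>UNIV. \<Sum>l\<in>UNIV. c i l * v i R * v l R)"
      using c_psd[of "\<lambda>i. v i R"] by simp
    then show "0 \<le> (\<Sum>i\<in>UNIV. v i R * (q i * x i ^ Suc r + eps i * hform (Suc r) (\<lambda>js. T (i # js)) x))"
      using ER by (simp add: E_def H_def XR)
  qed
qed

section \<open>Scaling a tensor that is dominant in pairs\<close>

text \<open>Brauer's condition makes the spectral radius of the nonnegative tensor \<open>d\<close> relative to \<open>p\<close> smaller than
  one, and a positive eigenvector provides the weights. To have a positive eigenvector, all entries are
  first increased by a small \<open>\<delta>\<close>; the finitely many strict inequalities survive. The eigenvector is a
  fixed point of the normalised \<open>k\<close>-th root of the map on the standard simplex, and its eigenvalue is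
  estimated by comparing its largest coordinate with any other one.\<close>

lemma exists_dominating_scaling:
  fixes d :: "'n::finite \<Rightarrow> 'n list \<Rightarrow> real" and p :: "'n \<Rightarrow> real"
  assumes k: "0 < k" and card: "2 \<le> CARD('n)"
    and d: "\<And>i js. length js = k \<Longrightarrow> 0 \<le> d i js"
    and p: "\<And>i. 0 < p i"
    and pair: "\<And>i j. i \<noteq> j \<Longrightarrow>
      d j (replicate k i) * hform k (d i) (\<lambda>_. 1)
        < p i * (p j - (hform k (d j) (\<lambda>_. 1) - d j (replicate k i)))"
  shows "\<exists>kap. (\<forall>i. 0 < kap i) \<and> (\<forall>i. hform k (d i) kap < p i * kap i ^ k)"
proof -
  define N where "N = real CARD('n) ^ k"
  define dl where "dl i = hform k (d i) (\<lambda>_. 1)" for i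
  have "\<forall>\<^sub>F \<delta> in at_right 0. \<forall>ij\<in>{(i, j). i \<noteq> j}. case ij of (i, j) \<Rightarrow>
      0 < p i * (p j - (dl j + \<delta> * N - (d j (replicate k i) + \<delta>)))
            - (d j (replicate k i) + \<delta>) * (dl i + \<delta> * N)"
  proof (intro eventually_ball_finite ballI)
    fix ij :: "'n \<times> 'n" assume "ij \<in> {(i, j). i \<noteq> j}"
    then obtain i j where ij: "ij = (i, j)" "i \<noteq> j" by auto
    let ?f = "\<lambda>\<delta>. p i * (p j - (dl j + \<delta> * N - (d j (replicate k i) + \<delta>)))
            - (d j (replicate k i) + \<delta>) * (dl i + \<delta> * N)"
    have "(?f \<longlongrightarrow> ?f 0) (at_right 0)" by (intro tendsto_intros)
    moreover have "0 < ?f 0" using pair[OF ij(2)] by (simp add: dl_def)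
    ultimately have "\<forall>\<^sub>F \<delta> in at_right 0. 0 < ?f \<delta>" by (rule order_tendstoD(1))
    then show "\<forall>\<^sub>F \<delta> in at_right 0. case ij of (i, j) \<Rightarrow>
      0 < p i * (p j - (dl j + \<delta> * N - (d j (replicate k i) + \<delta>)))
            - (d j (replicate k i) + \<delta>) * (dl i + \<delta> * N)"
      by (simp add: ij)
  qed (rule finite)
  then have "\<forall>\<^sub>F \<delta> in at_right 0. 0 < \<delta> \<and> (\<forall>ij\<in>{(i, j). i \<noteq> j}. case ij of (i, j) \<Rightarrow>
      0 < p i * (p j - (dl j + \<delta> * N - (d j (replicate k i) + \<delta>)))
            - (d j (replicate k i) + \<delta>) * (dl i + \<delta> * N))"
    using eventually_at_right_less[of "0::real"] by eventually_elim auto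
  then obtain \<delta> where \<delta>: "0 < \<delta>"
    and pair': "\<And>i j. i \<noteq> j \<Longrightarrow>
      (d j (replicate k i) + \<delta>) * (dl i + \<delta> * N)
        < p i * (p j - (dl j + \<delta> * N - (d j (replicate k i) + \<delta>)))"
    by (auto dest!: eventually_happens'[OF trivial_limit_at_right_real])
  define d' where "d' i js = d i js + \<delta>" for i js
  have d': "0 \<le> d' i js" if "length js = k" for i js
    using d[OF that, of i] \<delta> by (simp add: d'_def)
  have dl': "hform k (d' i) (\<lambda>_. 1) = dl i + \<delta> * N" for i
    by (simp add: d'_def[abs_def] hform_add hform_const dl_def N_def)
  define S where "S = {x :: real^'n. (\<forall>i. 0 \<le> x $ i) \<and> (\<Sum>i\<in>UNIV. x $ i) = 1}"
  define g where "g i x = root k (hform k (d' i) (($) x) / p i)" for i and x :: "real^'n"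
  define G where "G x = (\<Sum>i\<in>UNIV. g i x)" for x :: "real^'n"
  have lower: "\<delta> \<le> hform k (d' i) (($) x)" if "x \<in> S" for i x
  proof -
    have "\<bar>hform k (\<lambda>_. \<delta>) (($) x)\<bar> \<le> hform k (d' i) (($) x)"
      by (rule hform_abs_le) (use that d \<delta> in \<open>auto simp: S_def d'_def\<close>)
    then show ?thesis using that by (simp add: hform_const S_def)
  qed
  have g_pos: "0 < g i x" if "x \<in> S" for i x
    unfolding g_def using lower[OF that, of i] \<delta> p[of i] k by (auto intro!: real_root_gt_zero)
  have G_pos: "0 < G x" if "x \<in> S" for x
    unfolding G_def using g_pos[OF that] by (intro sum_pos) auto
  have S_le1: "x $ i \<le> 1" if "x \<in> S" for x i
    using that member_le_sum[of i UNIV "($) x"] by (auto simp: S_def)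
  have compact: "compact S"
  proof -
    have "S = (\<Inter>i. {x. 0 \<le> x $ i}) \<inter> {x. (\<Sum>i\<in>UNIV. x $ i) = 1}" by (auto simp: S_def)
    moreover have "closed \<dots>"
      by (intro closed_Int closed_INT ballI closed_Collect_le closed_Collect_eq continuous_intros)
    ultimately have "closed S" by simp
    moreover have "bounded S"
    proof -
      have "norm x \<le> 1" if "x \<in> S" for x
      proof -
        have "norm x \<le> (\<Sum>i\<in>UNIV. \<bar>x $ i\<bar>)" by (rule norm_le_l1_cart)
        also have "\<dots> = 1" using that by (simp add: S_def)
        finally show ?thesis .
      qed
      then show ?thesis by (auto simp: bounded_iff)
    qed
    ultimately show ?thesis by (simp add: compact_eq_bounded_closed)
  qed
  have convex: "convex S"
    unfolding convex_def by (auto simp: S_def sum.distrib sum_distrib_left[symmetric])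
  have "(\<chi> i. 1 / real CARD('n)) \<in> S" by (simp add: S_def)
  then have ne: "S \<noteq> {}" by auto
  have g_cont: "continuous_on S (g i)" for i
    unfolding g_def by (intro continuous_intros hform_continuous_on) (use p in \<open>auto simp: less_imp_neq[symmetric]\<close>)
  have f_cont: "continuous_on S (\<lambda>x. \<chi> i. g i x / G x)"
  proof (rule continuous_on_vec_lambda)
    show "continuous_on S (\<lambda>x. g i x / G x)" for i
      unfolding G_def by (intro continuous_intros g_cont) (use G_pos in \<open>force simp: G_def\<close>)
  qed
  have f_S: "(\<chi> i. g i x / G x) \<in> S" if "x \<in> S" for x
    using g_pos[OF that] G_pos[OF that]
    by (auto simp: S_def G_def less_imp_le sum_divide_distrib[symmetric])
  obtain x where x: "x \<in> S" "(\<chi> i. g i x / G x) = x"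
    using brouwer[OF compact convex ne f_cont] f_S by blast
  have xi: "x $ i = g i x / G x" for i
    by (metis x(2) vec_lambda_beta)
  have x_pos: "0 < x $ i" for i
    using g_pos[OF x(1), of i] G_pos[OF x(1)] by (simp add: xi)
  define lam where "lam = G x ^ k"
  have lam: "0 < lam" unfolding lam_def using G_pos[OF x(1)] by simp
  have eig: "hform k (d' i) (($) x) = p i * (lam * x $ i ^ k)" for i
  proof -
    have "(g i x) ^ k = hform k (d' i) (($) x) / p i"
      unfolding g_def using lower[OF x(1), of i] \<delta> p[of i] k by (intro real_root_pow_pos2) auto
    moreover have "g i x = G x * x $ i" using xi[of i] G_pos[OF x(1)] by simp
    ultimately show ?thesis using p[of i] by (simp add: lam_def power_mult_distrib field_simps)
  qed
  \<comment> \<open>Otherwise the row of the largest coordinate \<open>j\<close> and the row of \<open>i\<close> multiply to the opposite of the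
    assumed inequality for the pair \<open>i\<close>, \<open>j\<close>.\<close>
  have "lam < 1"
  proof (rule ccontr)
    assume "\<not> lam < 1"
    obtain j where j: "\<And>i. x $ i \<le> x $ j"
    proof -
      have "Max (range (($) x)) \<in> range (($) x)" by (rule Max_in) auto
      then obtain j where "x $ j = Max (range (($) x))" by (metis rangeE)
      then show ?thesis by (intro that[of j]) simp
    qed
    obtain i where i: "i \<noteq> j"
      using card by (metis (full_types) UNIV_eq_I card_1_singleton_iff insertI1 numeral_le_one_iff semiring_norm(69) One_nat_def)
    let ?e = "d j (replicate k i) + \<delta>"
    have xabs: "\<bar>x $ l\<bar> \<le> x $ j * 1" for l using j[of l] x_pos[of l] by simp
    have "hform k (d' j) (($) x) = hform k (\<lambda>js. d' j js - (if js = replicate k i then ?e else 0)) (($) x) + ?e * x $ i ^ k"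
      by (simp only: hform_diff hform_single)
    also have "hform k (\<lambda>js. d' j js - (if js = replicate k i then ?e else 0)) (($) x)
        \<le> hform k (\<lambda>js. d' j js - (if js = replicate k i then ?e else 0)) (\<lambda>_. x $ j * 1)"
      by (rule order_trans[OF abs_ge_self hform_abs_le[OF _ xabs]]) (use d' in \<open>auto simp: d'_def\<close>)
    also have "\<dots> = x $ j ^ k * (dl j + \<delta> * N - ?e)"
      by (simp only: hform_scale hform_diff hform_single dl') simp
    finally have 1: "p j * (lam * x $ j ^ k) \<le> x $ j ^ k * (dl j + \<delta> * N - ?e) + ?e * x $ i ^ k"
      by (simp add: eig)
    have "hform k (d' i) (($) x) \<le> hform k (d' i) (\<lambda>_. x $ j * 1)"
      by (rule order_trans[OF abs_ge_self hform_abs_le[OF _ xabs]]) (use d' in auto)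
    then have 2: "p i * (lam * x $ i ^ k) \<le> x $ j ^ k * (dl i + \<delta> * N)"
      by (simp only: eig hform_scale dl')
    define a where "a = x $ j ^ k"
    define c where "c = x $ i ^ k"
    have ac: "0 < a" "0 < c" using x_pos by (auto simp: a_def c_def)
    have "p j * a \<le> p j * (lam * a)" "p i * c \<le> p i * (lam * c)"
      using \<open>\<not> lam < 1\<close> ac p[of i] p[of j] by auto
    then have 3: "(p j - (dl j + \<delta> * N - ?e)) * a \<le> ?e * c" and 4: "p i * c \<le> (dl i + \<delta> * N) * a"
      using 1 2 by (auto simp: a_def[symmetric] c_def[symmetric] algebra_simps)
    have "p i * (p j - (dl j + \<delta> * N - ?e)) * a \<le> p i * (?e * c)"
      using 3 p[of i] by (simp add: mult.assoc)
    also have "\<dots> = ?e * (p i * c)" by simp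
    also have "\<dots> \<le> ?e * ((dl i + \<delta> * N) * a)"
      using 4 d[of "replicate k i" j] \<delta> by (intro mult_left_mono) auto
    finally have "p i * (p j - (dl j + \<delta> * N - ?e)) \<le> ?e * (dl i + \<delta> * N)"
      using ac by (simp add: mult.assoc[symmetric])
    then show False using pair'[OF i] by simp
  qed
  have "hform k (d i) (($) x) < p i * x $ i ^ k" for i
  proof -
    have "hform k (d i) (($) x) \<le> hform k (d' i) (($) x)"
      by (rule order_trans[OF abs_ge_self hform_abs_le]) (use d \<delta> x_pos in \<open>auto simp: d'_def abs_of_pos less_imp_le\<close>)
    also have "\<dots> = p i * (lam * x $ i ^ k)" by (rule eig)
    also have "\<dots> < p i * x $ i ^ k" using \<open>lam < 1\<close> p[of i] x_pos[of i] by simp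
    finally show ?thesis .
  qed
  then show ?thesis using x_pos by (intro exI[of _ "($) x"]) auto
qed

section \<open>Eigenvectors and signed dominance\<close>

lemma mset_eq_replicate:
  assumes "mset js = mset ks" shows "js = replicate k i \<longleftrightarrow> ks = replicate k i"
proof -
  have "js = replicate k i \<longleftrightarrow> length js = k \<and> (\<forall>l\<in>set js. l = i)" for js :: "'a list"
    by (auto intro: replicate_eqI)
  then show ?thesis using mset_eq_length[OF assms] mset_eq_setD[OF assms] by simp
qed

text \<open>Replacing the diagonal entries by \<open>eps i * b i\<close> keeps the tensor symmetric and makes
  \<open>weighted_signed_form_nonneg\<close> applicable with \<open>q i < p i\<close>. Since the signed rows of \<open>A - lam I\<close> vanish at \<open>x\<close>, the inequality
  obtained there forces \<open>w = 0\<close>, hence the sum of the coordinates of \<open>x\<close> is \<open>0\<close>. Then the multiples of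
  powers of this sum disappear from the rows and ordinary diagonal dominance, at the coordinate that is
  largest relative to \<open>kap\<close>, gives \<open>x = 0\<close>.\<close>

lemma no_signed_eigenvector:
  fixes A :: "'n::finite tensor" and eps b kap x :: "'n \<Rightarrow> real"
  assumes r: "even r" and sym: "symmetric_tensor (Suc (Suc r)) A"
    and eps: "\<And>i. eps i = 1 \<or> eps i = -1"
    and b: "\<And>i. 0 \<le> b i"
    and bound: "\<And>i js. length js = Suc r \<Longrightarrow> js \<noteq> replicate (Suc r) i \<Longrightarrow> eps i * A (i # js) \<le> b i"
    and kap: "\<And>i. 0 < kap i"
    and dom: "\<And>i. hform (Suc r) (\<lambda>js. if js = replicate (Suc r) i then 0 else b i - eps i * A (i # js)) kap
        < (eps i * (A (i # replicate (Suc r) i) - lam) - b i) * kap i ^ Suc r"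
    and eigen: "\<And>i. hform (Suc r) (\<lambda>js. A (i # js)) x = lam * x i ^ Suc r"
  shows "x i = 0"
proof -
  define T where "T js = (if \<exists>i. js = replicate (Suc (Suc r)) i then eps (hd js) * b (hd js) else A js)" for js
  define d where "d i js = (if js = replicate (Suc r) i then 0 else b i - eps i * A (i # js))" for i js
  define p where "p i = eps i * (A (i # replicate (Suc r) i) - lam) - b i" for i
  define q where "q i = hform (Suc r) (d i) kap / kap i ^ Suc r" for i
  have eps2: "eps i * eps i = 1" for i using eps[of i] by auto
  have T_Cons: "T (i # js) = (if js = replicate (Suc r) i then eps i * b i else A (i # js))" for i js
    by (auto simp: T_def)
  have d_T: "b i - eps i * T (i # js) = d i js" for i js
    by (simp add: T_Cons d_def mult.assoc[symmetric] eps2)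
  have symT: "T js = T ks" if "length js = Suc (Suc r)" "mset js = mset ks" for js ks
  proof (cases "\<exists>i. js = replicate (Suc (Suc r)) i")
    case True
    then obtain i where "js = replicate (Suc (Suc r)) i" ..
    then have "js = ks" using mset_eq_replicate[OF that(2), of "Suc (Suc r)" i] by (simp only:)
    then show ?thesis by simp
  next
    case False
    then have "\<not> (\<exists>i. ks = replicate (Suc (Suc r)) i)" by (simp only: mset_eq_replicate[OF that(2)] simp_thms)
    moreover have "A js = A ks"
      using that mset_eq_length[OF that(2)]
      by (intro sym[unfolded symmetric_tensor_def, rule_format]) (simp_all add: multi_indices_def)
    ultimately show ?thesis using False by (simp add: T_def)
  qed
  have d_nn: "0 \<le> d i js" if "length js = Suc r" for i js
    using bound[OF that, of i] by (auto simp: d_def)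
  have boundT: "eps i * T (i # js) \<le> b i" if "length js = Suc r" for i js
    using d_nn[OF that, of i] d_T[of i js] by linarith
  have q: "q i * kap i ^ Suc r = hform (Suc r) (\<lambda>js. b i - eps i * T (i # js)) kap" for i
    using kap[of i] by (simp add: q_def d_T)
  have q_less: "q i < p i" for i
    using dom[of i] kap[of i] by (simp add: q_def p_def d_def[abs_def] divide_less_eq)
  have row: "eps i * hform (Suc r) (\<lambda>js. T (i # js)) x = - p i * x i ^ Suc r" for i
  proof -
    let ?a = "A (i # replicate (Suc r) i) - eps i * b i"
    have "hform (Suc r) (\<lambda>js. A (i # js)) x
        = hform (Suc r) (\<lambda>js. T (i # js) + (if js = replicate (Suc r) i then ?a else 0)) x"
      by (intro hform_cong) (auto simp: T_Cons)
    then have "hform (Suc r) (\<lambda>js. T (i # js)) x = (lam - ?a) * x i ^ Suc r"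
      by (simp add: hform_add hform_single eigen algebra_simps del: replicate.simps)
    then have "eps i * hform (Suc r) (\<lambda>js. T (i # js)) x = (eps i * lam - eps i * ?a) * x i ^ Suc r"
      by (simp only: mult.assoc[symmetric] right_diff_distrib)
    also have "eps i * lam - eps i * ?a = - p i"
      by (simp add: p_def right_diff_distrib mult.assoc[symmetric] eps2)
    finally show ?thesis .
  qed
  obtain w where w_x: "\<And>i. 0 \<le> w i * x i" and w_0: "\<And>i. x i = 0 \<Longrightarrow> w i = 0"
    and w_sum: "real (Suc r) * (\<Sum>i\<in>UNIV. w i) = (\<Sum>i\<in>UNIV. x i) ^ Suc r"
    and w_form: "0 \<le> (\<Sum>i\<in>UNIV. w i * (q i * x i ^ Suc r + eps i * hform (Suc r) (\<lambda>js. T (i # js)) x))"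
    using weighted_signed_form_nonneg[OF r symT eps b boundT kap q, where x=x] by blast
  have "(\<Sum>i\<in>UNIV. (p i - q i) * (w i * x i * x i ^ r)) \<le> 0"
  proof -
    have "(\<Sum>i\<in>UNIV. w i * (q i * x i ^ Suc r + eps i * hform (Suc r) (\<lambda>js. T (i # js)) x))
       = - (\<Sum>i\<in>UNIV. (p i - q i) * (w i * x i * x i ^ r))"
      unfolding row sum_negf[symmetric] by (intro sum.cong refl) (simp add: algebra_simps)
    then show ?thesis using w_form by simp
  qed
  moreover have nn: "0 \<le> (p i - q i) * (w i * x i * x i ^ r)" for i
    using q_less[of i] w_x[of i] zero_le_even_power[OF r, of "x i"] by simp
  ultimately have "(\<Sum>i\<in>UNIV. (p i - q i) * (w i * x i * x i ^ r)) = 0"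
    by (intro antisym sum_nonneg) auto
  then have zero: "(p i - q i) * (w i * x i * x i ^ r) = 0" for i
    using nn by (subst (asm) sum_nonneg_eq_0_iff) auto
  have "w i = 0" for i
  proof -
    have "w i * x i * x i ^ r = 0" using zero[of i] q_less[of i] by (simp only: mult_eq_0_iff) linarith
    then have "w i = 0 \<or> x i = 0" by (simp only: mult_eq_0_iff power_eq_0_iff) blast
    then show ?thesis using w_0 by blast
  qed
  then have s: "(\<Sum>i\<in>UNIV. x i) = 0" using w_sum by auto
  \<comment> \<open>From here on \<open>x\<close> solves the dominated system \<open>p j * x j ^ Suc r = hform (Suc r) (d j) x\<close>.\<close>
  define M where "M = Max (range (\<lambda>i. \<bar>x i\<bar> / kap i))"
  have "M \<in> range (\<lambda>i. \<bar>x i\<bar> / kap i)" unfolding M_def by (rule Max_in) auto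
  then obtain j where j: "M = \<bar>x j\<bar> / kap j" by auto
  have le: "\<bar>x l\<bar> \<le> M * kap l" for l
  proof -
    have "\<bar>x l\<bar> / kap l \<le> M" unfolding M_def by simp
    then show ?thesis using kap[of l] by (simp add: divide_le_eq)
  qed
  have "p j * x j ^ Suc r = hform (Suc r) (d j) x"
  proof -
    have "hform (Suc r) (d j) x = hform (Suc r) (\<lambda>js. b j - eps j * T (j # js)) x" by (simp add: d_T)
    also have "\<dots> = b j * (\<Sum>l\<in>UNIV. x l) ^ Suc r - eps j * hform (Suc r) (\<lambda>js. T (j # js)) x"
      by (simp only: hform_diff hform_const hform_cmult)
    finally show ?thesis by (simp add: s row)
  qed
  moreover have "\<bar>hform (Suc r) (d j) x\<bar> \<le> hform (Suc r) (d j) (\<lambda>l. M * kap l)"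
    by (rule hform_abs_le) (use le d_nn in auto)
  moreover have "hform (Suc r) (d j) (\<lambda>l. M * kap l) = q j * \<bar>x j\<bar> ^ Suc r"
    using kap[of j] by (simp only: hform_scale) (simp add: q_def j power_divide)
  ultimately have "\<bar>p j * x j ^ Suc r\<bar> \<le> q j * \<bar>x j\<bar> ^ Suc r" by (simp only:)
  then have "\<bar>p j\<bar> * \<bar>x j\<bar> ^ Suc r \<le> q j * \<bar>x j\<bar> ^ Suc r"
    by (simp only: abs_mult power_abs)
  then have "(\<bar>p j\<bar> - q j) * \<bar>x j\<bar> ^ Suc r \<le> 0" by (simp add: algebra_simps)
  moreover have "0 < (\<bar>p j\<bar> - q j) * \<bar>x j\<bar> ^ Suc r" if "x j \<noteq> 0"
    using that q_less[of j] by (intro mult_pos_pos zero_less_power) auto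
  ultimately have "x j = 0" by (meson not_less)
  then show "x i = 0" using le[of i] j by simp
qed

section \<open>The quasi-double intervals\<close>

lemma finite_off_diag: "finite (off_diag m (i :: 'n::finite))"
  by (simp add: off_diag_def finite_multi_indices)

lemma beta_bounds:
  shows "0 \<le> beta m A i" and "js \<in> off_diag m i \<Longrightarrow> A (i # js) \<le> beta m A i"
  by (auto simp: beta_def finite_off_diag intro!: Max_ge)

lemma gamma_bounds:
  shows "gamma m A i \<le> 0" and "js \<in> off_diag m i \<Longrightarrow> gamma m A i \<le> A (i # js)"
  by (auto simp: gamma_def finite_off_diag intro!: Min_le)

text \<open>The four sets \<open>Psi1\<close> to \<open>Psi4\<close> are the four sign patterns of a pair of rows; \<open>lam\<close> avoiding the set that
  belongs to its pattern is the pair condition of \<open>exists_dominating_scaling\<close>.\<close>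

lemma H_eigenvalue_in_Psi:
  fixes A :: "'n::finite tensor"
  assumes "even m" "2 \<le> m" "2 \<le> CARD('n)" "symmetric_tensor m A" "H_eigenvalue m A lam"
  shows "lam \<in> Psi m A"
proof (rule ccontr)
  assume notin: "lam \<notin> Psi m A"
  obtain r where m: "m = Suc (Suc r)" using assms(2) by (metis add_2_eq_Suc le_Suc_ex)
  have r: "even r" using assms(1) m by simp
  obtain x where "x \<noteq> 0" and x: "tensor_apply m A x = lam *\<^sub>R vec_power x (m - 1)"
    using assms(5) unfolding H_eigenvalue_def by blast
  define P where "P i \<longleftrightarrow> lam < diag_entry m A i" for i
  define eps :: "'n \<Rightarrow> real" where "eps i = (if P i then 1 else -1)" for i
  define b where "b i = (if P i then beta m A i else - gamma m A i)" for i
  define p where "p i = eps i * (diag_entry m A i - lam) - b i" for i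
  define d where "d i js = (if js = replicate (m - 1) i then 0 else b i - eps i * A (i # js))" for i js
  have eps: "eps i = 1 \<or> eps i = -1" for i by (simp add: eps_def)
  have b: "0 \<le> b i" for i by (simp add: b_def beta_bounds gamma_bounds)
  have bound: "eps i * A (i # js) \<le> b i" if "js \<in> off_diag m i" for i js
    using beta_bounds(2)[OF that, of A] gamma_bounds(2)[OF that, of A] by (simp add: eps_def b_def)
  have single: "lam < diag_entry m A i - beta m A i \<or> diag_entry m A i - gamma m A i < lam" for i
    using notin by (auto simp: Psi_def Psi_single_def not_le)
  have P_iff: "P i \<longleftrightarrow> lam < diag_entry m A i - beta m A i" "\<not> P i \<longleftrightarrow> diag_entry m A i - gamma m A i < lam" for i
    using single[of i] beta_bounds(1)[of m A i] gamma_bounds(1)[of m A i] unfolding P_def by linarith+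
  have p: "0 < p i" for i
    using P_iff[of i] by (auto simp: p_def eps_def b_def)
  have d: "0 \<le> d i js" if "length js = m - 1" for i js
    using bound[of js i] that by (auto simp: d_def off_diag_def multi_indices_def)
  have d1: "hform (m - 1) (d i) (\<lambda>_. 1) = (\<Sum>js\<in>off_diag m i. b i - eps i * A (i # js))" for i
    unfolding d_def by (rule hform_off_diag)
  have pair: "d j (replicate (m - 1) i) * hform (m - 1) (d i) (\<lambda>_. 1)
        < p i * (p j - (hform (m - 1) (d j) (\<lambda>_. 1) - d j (replicate (m - 1) i)))" if ij: "i \<noteq> j" for i j
  proof -
    have "lam \<in> Psi m A" if "lam \<in> Psi_pair m A i j"
      unfolding Psi_def using ij that by (intro UnI2 UN_I[of i] UN_I[of j]) auto
    then have notpair: "lam \<notin> Psi_pair m A i j" using notin by blast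
    have ne: "replicate (m - 1) i \<noteq> replicate (m - 1) j" using assms(2) ij by (simp add: replicate_eq_replicate)
    have semi: "d j (replicate (m - 1) i) = b j - eps j * semi_diag_entry m A j i"
      using ne by (simp add: d_def semi_diag_entry_def)
    have D: "hform (m - 1) (d i) (\<lambda>_. 1) = (if P i then Delta m A i else Theta m A i)" for i
      unfolding d1 by (auto simp: b_def eps_def Delta_def Theta_def intro!: sum.cong)
    have D2: "hform (m - 1) (d j) (\<lambda>_. 1) - d j (replicate (m - 1) i)
        = (if P j then Delta_except m A j i else Theta_except m A j i)"
    proof -
      have "hform (m - 1) (d j) (\<lambda>_. 1) - d j (replicate (m - 1) i)
        = (\<Sum>js\<in>off_diag2 m i j. b j - eps j * A (j # js))"
        unfolding d1 using ne by (simp add: off_diag2_sum[OF ij assms(2)] d_def)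
      then show ?thesis
        by (auto simp: b_def eps_def Delta_except_def Theta_except_def intro!: sum.cong)
    qed
    have absp: "p l = (if P l then \<bar>diag_entry m A l - beta m A l - lam\<bar> else \<bar>diag_entry m A l - gamma m A l - lam\<bar>)" for l
      using p[of l] by (auto simp: p_def eps_def b_def)
    have P: "P l \<longleftrightarrow> lam < diag_entry m A l" "\<not> P l \<longleftrightarrow> diag_entry m A l < lam" for l
      using P_iff[of l] gamma_bounds(1)[of m A l] unfolding P_def by linarith+
    show ?thesis
    proof (cases "P i"; cases "P j")
      assume "P i" "P j"
      then have "lam \<in> {..<min (diag_entry m A i) (diag_entry m A j)}" using P(1) by simp
      then show ?thesis using notpair \<open>P i\<close> \<open>P j\<close> unfolding D2 unfolding D semi absp
        by (auto simp: Psi_pair_def Psi1_def b_def eps_def not_le split: if_splits)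
    next
      assume "P i" "\<not> P j"
      then have "lam \<in> {diag_entry m A j<..<diag_entry m A i}" using P by simp
      then show ?thesis using notpair \<open>P i\<close> \<open>\<not> P j\<close> unfolding D2 unfolding D semi absp
        by (auto simp: Psi_pair_def Psi3_def b_def eps_def not_le split: if_splits)
    next
      assume "\<not> P i" "P j"
      then have "lam \<in> {diag_entry m A i<..<diag_entry m A j}" using P by simp
      then show ?thesis using notpair \<open>\<not> P i\<close> \<open>P j\<close> unfolding D2 unfolding D semi absp
        by (auto simp: Psi_pair_def Psi2_def b_def eps_def not_le split: if_splits)
    next
      assume "\<not> P i" "\<not> P j"
      then have "lam \<in> {max (diag_entry m A i) (diag_entry m A j)<..}" using P(2) by simp
      then show ?thesis using notpair \<open>\<not> P i\<close> \<open>\<not> P j\<close> unfolding D2 unfolding D semi absp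
        by (auto simp: Psi_pair_def Psi4_def b_def eps_def not_le split: if_splits)
    qed
  qed
  obtain kap where kap: "\<And>i. 0 < kap i" and dom: "\<And>i. hform (m - 1) (d i) kap < p i * kap i ^ (m - 1)"
    using exists_dominating_scaling[OF _ assms(3) d p pair] assms(2) by auto
  have "x $ i = 0" for i
  proof (rule no_signed_eigenvector[where r=r and A=A and eps=eps and b=b and kap=kap and lam=lam])
    show "symmetric_tensor (Suc (Suc r)) A" using assms(4) m by simp
    show "eps i * A (i # js) \<le> b i" if "length js = Suc r" "js \<noteq> replicate (Suc r) i" for i js
      using that m by (intro bound) (auto simp: off_diag_def multi_indices_def)
    show "hform (Suc r) (\<lambda>js. if js = replicate (Suc r) i then 0 else b i - eps i * A (i # js)) kap
        < (eps i * (A (i # replicate (Suc r) i) - lam) - b i) * kap i ^ Suc r" for i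
      using dom[of i] unfolding p_def d_def[abs_def] diag_entry_Cons[OF assms(2)]
      by (simp add: m del: replicate.simps power_Suc)
    show "hform (Suc r) (\<lambda>js. A (i # js)) (($) x) = lam * x $ i ^ Suc r" for i
      using arg_cong[OF x, of "\<lambda>y. y $ i"] by (simp add: tensor_apply_def vec_power_def hform_def m)
  qed (use r eps b kap in auto)
  then show False using \<open>x \<noteq> 0\<close> by (simp add: vec_eq_iff)
qed

section \<open>The Brauer-type set\<close>

text \<open>The index \<open>j\<close> maximises \<open>\<bar>x $ j\<bar>\<close>, and \<open>i\<close> may be any other index: only the entry \<open>a_{j i ... i}\<close> of row
  \<open>j\<close> is paired with the coordinate \<open>x $ i\<close>, and row \<open>i\<close> bounds that coordinate in return.\<close>

lemma H_eigenvalue_in_Omega: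
  fixes A :: "'n::finite tensor"
  assumes "2 \<le> m" "2 \<le> CARD('n)" "H_eigenvalue m A lam"
  shows "complex_of_real lam \<in> Omega m A"
proof -
  define k where "k = m - 1"
  obtain x where "x \<noteq> 0" and x: "tensor_apply m A x = lam *\<^sub>R vec_power x k"
    using assms(3) unfolding H_eigenvalue_def k_def by blast
  obtain j where j: "\<And>i. \<bar>x $ i\<bar> \<le> \<bar>x $ j\<bar>"
  proof -
    have "Max (range (\<lambda>i. \<bar>x $ i\<bar>)) \<in> range (\<lambda>i. \<bar>x $ i\<bar>)" by (rule Max_in) auto
    then obtain j where "\<bar>x $ j\<bar> = Max (range (\<lambda>i. \<bar>x $ i\<bar>))" by (metis rangeE)
    then show ?thesis by (intro that[of j]) simp
  qed
  have xj: "0 < \<bar>x $ j\<bar>"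
  proof (rule ccontr)
    assume "\<not> 0 < \<bar>x $ j\<bar>"
    then have "x $ i = 0" for i using j[of i] by simp
    then show False using \<open>x \<noteq> 0\<close> by (simp add: vec_eq_iff)
  qed
  obtain i where i: "i \<noteq> j"
    using assms(2) by (metis (full_types) UNIV_eq_I card_1_singleton_iff insertI1 numeral_le_one_iff semiring_norm(69) One_nat_def)
  have row: "(lam - diag_entry m A l) * x $ l ^ k
      = hform k (\<lambda>js. if js = replicate k l then 0 else A (l # js)) (($) x)" for l
  proof -
    have "lam * x $ l ^ k = hform k (\<lambda>js. A (l # js)) (($) x)"
      using arg_cong[OF x, of "\<lambda>y. y $ l"] by (simp add: tensor_apply_def vec_power_def hform_def k_def)
    also have "\<dots> = hform k (\<lambda>js. (if js = replicate k l then 0 else A (l # js))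
        + (if js = replicate k l then diag_entry m A l else 0)) (($) x)"
      using assms(1) by (intro hform_cong) (auto simp: diag_entry_Cons k_def)
    also have "\<dots> = hform k (\<lambda>js. if js = replicate k l then 0 else A (l # js)) (($) x) + diag_entry m A l * x $ l ^ k"
      by (simp only: hform_add hform_single)
    finally show ?thesis by (simp add: algebra_simps)
  qed
  define a where "a = \<bar>x $ j\<bar> ^ k"
  define c where "c = \<bar>x $ i\<bar> ^ k"
  define e where "e = \<bar>semi_diag_entry m A j i\<bar>"
  have a: "0 < a" using xj by (simp add: a_def)
  have xabs: "\<bar>x $ l\<bar> \<le> \<bar>x $ j\<bar> * 1" for l using j[of l] by simp
  have radius: "hform k (\<lambda>js. if js = replicate k l then 0 else \<bar>A (l # js)\<bar>) (\<lambda>_. \<bar>x $ j\<bar> * 1) = a * row_radius m A l" for l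
    unfolding hform_scale k_def hform_off_diag row_radius_def a_def by simp
  have "\<bar>lam - diag_entry m A i\<bar> * c \<le> a * row_radius m A i"
  proof -
    have "\<bar>lam - diag_entry m A i\<bar> * c = \<bar>hform k (\<lambda>js. if js = replicate k i then 0 else A (i # js)) (($) x)\<bar>"
      by (simp add: row[symmetric] abs_mult power_abs c_def)
    also have "\<dots> \<le> hform k (\<lambda>js. if js = replicate k i then 0 else \<bar>A (i # js)\<bar>) (\<lambda>_. \<bar>x $ j\<bar> * 1)"
      by (rule hform_abs_le) (use xabs in auto)
    finally show ?thesis by (simp only: radius)
  qed
  moreover have "\<bar>lam - diag_entry m A j\<bar> * a \<le> a * row_radius_except m A j i + e * c"
  proof -
    let ?B = "\<lambda>js. if js = replicate k j then 0 else A (j # js)"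
    let ?D = "\<lambda>js. if js = replicate k j then 0 else \<bar>A (j # js)\<bar>"
    have ne: "replicate k i \<noteq> replicate k j" using assms(1) i by (simp add: replicate_eq_replicate k_def)
    have "hform k ?B (($) x) = hform k (\<lambda>js. ?B js - (if js = replicate k i then semi_diag_entry m A j i else 0)) (($) x)
        + semi_diag_entry m A j i * x $ i ^ k"
      by (simp only: hform_diff hform_single)
    moreover have "\<bar>hform k (\<lambda>js. ?B js - (if js = replicate k i then semi_diag_entry m A j i else 0)) (($) x)\<bar>
        \<le> hform k (\<lambda>js. ?D js - (if js = replicate k i then e else 0)) (\<lambda>_. \<bar>x $ j\<bar> * 1)"
      by (rule hform_abs_le) (use xabs ne in \<open>auto simp: e_def semi_diag_entry_def k_def\<close>)
    moreover have "hform k (\<lambda>js. ?D js - (if js = replicate k i then e else 0)) (\<lambda>_. \<bar>x $ j\<bar> * 1)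
        = a * row_radius_except m A j i"
      unfolding hform_diff hform_single radius by (simp add: row_radius_except_def a_def e_def algebra_simps)
    moreover have "\<bar>lam - diag_entry m A j\<bar> * a = \<bar>hform k ?B (($) x)\<bar>"
      by (simp add: row[symmetric] abs_mult power_abs a_def)
    moreover have "\<bar>semi_diag_entry m A j i * x $ i ^ k\<bar> = e * c"
      by (simp add: abs_mult power_abs e_def c_def)
    ultimately show ?thesis by linarith
  qed
  ultimately have "a * (\<bar>lam - diag_entry m A i\<bar> * (\<bar>lam - diag_entry m A j\<bar> - row_radius_except m A j i))
      \<le> a * (row_radius m A i * e)"
  proof -
    assume 1: "\<bar>lam - diag_entry m A i\<bar> * c \<le> a * row_radius m A i"
      and 2: "\<bar>lam - diag_entry m A j\<bar> * a \<le> a * row_radius_except m A j i + e * c"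
    have "a * (\<bar>lam - diag_entry m A i\<bar> * (\<bar>lam - diag_entry m A j\<bar> - row_radius_except m A j i))
       = \<bar>lam - diag_entry m A i\<bar> * (\<bar>lam - diag_entry m A j\<bar> * a - a * row_radius_except m A j i)"
      by (simp add: algebra_simps)
    also have "\<dots> \<le> \<bar>lam - diag_entry m A i\<bar> * (e * c)"
      using 2 by (intro mult_left_mono) auto
    also have "\<dots> = e * (\<bar>lam - diag_entry m A i\<bar> * c)" by simp
    also have "\<dots> \<le> e * (a * row_radius m A i)"
      using 1 by (intro mult_left_mono) (auto simp: e_def)
    finally show ?thesis by (simp add: mult_ac)
  qed
  moreover have "cmod (complex_of_real lam - complex_of_real y) = \<bar>lam - y\<bar>" for y
    by (metis norm_of_real of_real_diff)
  ultimately have "complex_of_real lam \<in> Omega_pair m A i j"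
    using a by (simp add: Omega_pair_def e_def)
  then show ?thesis unfolding Omega_def using i by (intro UN_I[of i] UN_I[of j]) auto
qed

section \<open>The combined inclusion\<close>

theorem theorem5p2:
  fixes A :: "'n::finite tensor" and m :: nat and lam :: real
  assumes "even m" and "m \<ge> 2"
    and "CARD('n) \<ge> 2"
    and "symmetric_tensor m A"
    and "H_eigenvalue m A lam"
  shows "complex_of_real lam \<in> Upsilon m A"
  unfolding Upsilon_def
  using H_eigenvalue_in_Omega[OF assms(2,3,5)] H_eigenvalue_in_Psi[OF assms] by auto

end
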